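(* Let $R=\mathbb F_q[X;\sigma]/(X^2)$ for some $\sigma\in\mathrm{Aut}(\mathbb F_q)$. Let $\mathcal K$ be the orbit of a point $p$ of the Barbilian space of $R^3_R$ under an embedded Singer cycle, $\mathcal K$ being a set of $q^2+q+1$ points that shares exactly $1$ or $q+1$ points with every hyperplane of the Barbilian space. Let $Y$ be a $3\times(q^2+q+1)$ matrix over $R$ whose columns generate the points of $\mathcal K$, and let $C=\{xY\mid x\in R^3\}$, which is a two-weight code with normalized homogeneous weights $\frac{q^3}{q-1}$ and $q^2$. Then the graph with vertex set $C$, in which $x,y\in C$ are adjacent iff $\mathrm{w}_{\mathrm{hom}}(x-y)=q^2$, is strongly regular with parameters $$N=q^6,\quad K=q^4-q,\quad\lambda=q^3+q^2-3q,\quad \mu=q^2-q.$$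
   Context: $\mathbb F_q[X;\sigma]$ is the skew polynomial ring with $Xa=\sigma(a)X$ for $a\in\mathbb F_q$; $R=\mathbb F_q[X;\sigma]/(X^2)$ is a finite chain ring of length $2$ with $\mathrm{Rad}(R)=RX$, residue field $\mathbb F_q$, and contains $\mathbb F_q$ as the subring of constants. Points of the Barbilian space of $R^3_R$ are the submodules $xR$, $x\in R^3$, with $\varphi(x)=1$ for some $\varphi\in \mathrm{Hom}(R^3_R,R_R)$; hyperplanes are the submodules $R\varphi$, $\varphi\in\mathrm{Hom}(R^3_R,R_R)$, with $\varphi(x)=1$ for some $x\in R^3$; the point $xR$ lies on the hyperplane $R\varphi$ iff $\varphi(x)=0$. A Singer cycle of $\mathrm{PGL}(3,\mathbb F_q)$ is a cyclic group of order $q^2+q+1$ acting regularly on the points of $\mathrm{PG}(2,q)$. It is embedded as follows: it is induced by a matrix $S\in\mathrm{GL}(3,\mathbb F_q)$, which is regarded as a matrix over $R$ via $\mathbb F_q\subseteq R$ and acts on points by $xR\mapsto (Sx)R$; the orbit of $p$ is its orbit under the group generated by $S$. The normalized homogeneous weight $\mathrm{w}_{\mathrm{hom}}$ on $R$ is the unique map $w:R\to\mathbb R_{\ge0}$ with $w(0)=0$, $w(x)=w(y)$ whenever $Rx=Ry$, and $\sum_{y\in Rx}w(y)=|Rx|$ for all $x\neq0$; here it is $0$ at $0$, $\frac{q}{q-1}$ on $\mathrm{Rad}(R)\setminus\{0\}$, and $1$ on units. It is extended to $R^n$ by summing over coordinates. A two-weight code is a linear code $C\le{}_RR^n$ with $\mathrm{w}_{\mathrm{hom}}(c)>0$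 for all nonzero $c\in C$ and on which the homogeneous weight takes exactly two nonzero values. A simple graph is strongly regular with parameters $(N,K,\lambda,\mu)$ if it has $N$ vertices, is neither empty nor complete, is regular of degree $K$, every two adjacent vertices have exactly $\lambda$ common neighbours, and every two distinct non-adjacent vertices have exactly $\mu$ common neighbours. *)

theory Defs
  imports
    "HOL-Analysis.Cartesian_Space"
    "HOL-Computational_Algebra.Polynomial"
    "HOL-Algebra.QuotRing"
    "HOL-Algebra.Elementary_Groups"
begin

section \<open>The chain ring\<close>

definition field_aut :: "('a::field \<Rightarrow> 'a) \<Rightarrow> bool" where
  "field_aut \<sigma> \<longleftrightarrow> bij \<sigma> \<and> (\<forall>a b. \<sigma> (a + b) = \<sigma> a + \<sigma> b) \<and> (\<forall>a b. \<sigma> (a * b) = \<sigma> a * \<sigma> b)"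

text \<open>Coefficients are written on the left of the powers of \<open>X\<close>, so \<open>X a = \<sigma>(a) X\<close> gives
  \<open>(a X\<^sup>i) (b X\<^sup>j) = a \<sigma>\<^sup>i(b) X\<^sup>i\<^sup>+\<^sup>j\<close>. The type of ordinary polynomials only serves as the underlying
  additive group.\<close>

definition skew_mult :: "('a::field \<Rightarrow> 'a) \<Rightarrow> 'a poly \<Rightarrow> 'a poly \<Rightarrow> 'a poly" where
  "skew_mult \<sigma> f g =
     (\<Sum>i\<le>degree f. \<Sum>j\<le>degree g. monom (coeff f i * (\<sigma> ^^ i) (coeff g j)) (i + j))"

definition skew_poly_ring :: "('a::field \<Rightarrow> 'a) \<Rightarrow> 'a poly ring" where
  "skew_poly_ring \<sigma> =
     \<lparr>carrier = UNIV, mult = skew_mult \<sigma>, one = 1, zero = 0, add = (+)\<rparr>"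

definition X2_ideal :: "('a::field \<Rightarrow> 'a) \<Rightarrow> 'a poly set" where
  "X2_ideal \<sigma> = Idl\<^bsub>skew_poly_ring \<sigma>\<^esub> {monom 1 2}"

definition chain_ring :: "('a::field \<Rightarrow> 'a) \<Rightarrow> 'a poly set ring" where
  "chain_ring \<sigma> = skew_poly_ring \<sigma> Quot X2_ideal \<sigma>"

definition const_emb :: "('a::field \<Rightarrow> 'a) \<Rightarrow> 'a \<Rightarrow> 'a poly set" where
  "const_emb \<sigma> a = X2_ideal \<sigma> +>\<^bsub>skew_poly_ring \<sigma>\<^esub> [:a:]"

section \<open>Free modules and the Barbilian space\<close>

text \<open>Since \<open>R\<close> is a record and not a type class instance, the type \<open>'r ^ 'n\<close> is used here purely
  as a type of \<open>'n\<close>-indexed tuples; all operations come from \<open>R\<close>.\<close>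

definition free_module :: "('r, 'm) ring_scheme \<Rightarrow> ('r ^ 'n) set" where
  "free_module R = {x. \<forall>i. x $ i \<in> carrier R}"

definition vzero :: "('r, 'm) ring_scheme \<Rightarrow> 'r ^ 'n" where
  "vzero R = (\<chi> i. \<zero>\<^bsub>R\<^esub>)"

definition vadd :: "('r, 'm) ring_scheme \<Rightarrow> 'r ^ 'n \<Rightarrow> 'r ^ 'n \<Rightarrow> 'r ^ 'n" where
  "vadd R x y = (\<chi> i. x $ i \<oplus>\<^bsub>R\<^esub> y $ i)"

definition vminus :: "('r, 'm) ring_scheme \<Rightarrow> 'r ^ 'n \<Rightarrow> 'r ^ 'n \<Rightarrow> 'r ^ 'n" where
  "vminus R x y = (\<chi> i. x $ i \<ominus>\<^bsub>R\<^esub> y $ i)"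

definition lscale :: "('r, 'm) ring_scheme \<Rightarrow> 'r \<Rightarrow> 'r ^ 'n \<Rightarrow> 'r ^ 'n" where
  "lscale R r x = (\<chi> i. r \<otimes>\<^bsub>R\<^esub> x $ i)"

definition rscale :: "('r, 'm) ring_scheme \<Rightarrow> 'r ^ 'n \<Rightarrow> 'r \<Rightarrow> 'r ^ 'n" where
  "rscale R x r = (\<chi> i. x $ i \<otimes>\<^bsub>R\<^esub> r)"

definition mat_vec :: "('r, 'm) ring_scheme \<Rightarrow> 'r ^ 'n ^ 'k \<Rightarrow> 'r ^ 'n \<Rightarrow> 'r ^ 'k" where
  "mat_vec R A x = (\<chi> i. \<Oplus>\<^bsub>R\<^esub>j\<in>UNIV. A $ i $ j \<otimes>\<^bsub>R\<^esub> x $ j)"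

definition vec_mat :: "('r, 'm) ring_scheme \<Rightarrow> 'r ^ 'k \<Rightarrow> 'r ^ 'n ^ 'k \<Rightarrow> 'r ^ 'n" where
  "vec_mat R x A = (\<chi> j. \<Oplus>\<^bsub>R\<^esub>i\<in>UNIV. x $ i \<otimes>\<^bsub>R\<^esub> A $ i $ j)"

definition right_span :: "('r, 'm) ring_scheme \<Rightarrow> 'r ^ 'n \<Rightarrow> ('r ^ 'n) set" where
  "right_span R x = {rscale R x r | r. r \<in> carrier R}"

text \<open>\<open>Hom(R\<^sup>n\<^sub>R, R\<^sub>R)\<close>, which is a left \<open>R\<close>-module by \<open>(r \<phi>)(x) = r \<phi>(x)\<close>.
  Functions are made extensional so that equality of functionals is equality on \<open>R\<^sup>n\<close>.\<close>

definition functionals :: "('r, 'm) ring_scheme \<Rightarrow> ('r ^ 'n \<Rightarrow> 'r) set" where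
  "functionals R = {\<phi> \<in> free_module R \<rightarrow>\<^sub>E carrier R.
     (\<forall>x\<in>free_module R. \<forall>y\<in>free_module R. \<phi> (vadd R x y) = \<phi> x \<oplus>\<^bsub>R\<^esub> \<phi> y) \<and>
     (\<forall>x\<in>free_module R. \<forall>r\<in>carrier R. \<phi> (rscale R x r) = \<phi> x \<otimes>\<^bsub>R\<^esub> r)}"

definition functional_span :: "('r, 'm) ring_scheme \<Rightarrow> ('r ^ 'n \<Rightarrow> 'r) \<Rightarrow> ('r ^ 'n \<Rightarrow> 'r) set" where
  "functional_span R \<phi> = {\<lambda>x\<in>free_module R. r \<otimes>\<^bsub>R\<^esub> \<phi> x | r. r \<in> carrier R}"

definition barb_points :: "('r, 'm) ring_scheme \<Rightarrow> ('r ^ 'n) set set" where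
  "barb_points R =
     {right_span R x | x. x \<in> free_module R \<and> (\<exists>\<phi>\<in>functionals R. \<phi> x = \<one>\<^bsub>R\<^esub>)}"

definition barb_hyperplanes :: "('r, 'm) ring_scheme \<Rightarrow> ('r ^ 'n \<Rightarrow> 'r) set set" where
  "barb_hyperplanes R =
     {functional_span R \<phi> | \<phi>. \<phi> \<in> functionals R \<and> (\<exists>x\<in>free_module R. \<phi> x = \<one>\<^bsub>R\<^esub>)}"

definition lies_on ::
    "('r, 'm) ring_scheme \<Rightarrow> ('r ^ 'n) set \<Rightarrow> ('r ^ 'n \<Rightarrow> 'r) set \<Rightarrow> bool" where
  "lies_on R P H \<longleftrightarrow> (\<exists>x\<in>free_module R. \<exists>\<phi>\<in>functionals R.
     P = right_span R x \<and> H = functional_span R \<phi> \<and> \<phi> x = \<zero>\<^bsub>R\<^esub>)"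

section \<open>Singer cycles\<close>

definition GL3 :: "('a::field ^ 3 ^ 3) monoid" where
  "GL3 = \<lparr>carrier = {A. invertible A}, mult = (**), one = mat 1\<rparr>"

definition scalars3 :: "('a::field ^ 3 ^ 3) set" where
  "scalars3 = {mat c | c. c \<noteq> 0}"

definition PGL3 :: "('a::field ^ 3 ^ 3) set monoid" where
  "PGL3 = GL3 Mod scalars3"

definition pg2_points :: "('a::field ^ 3) set set" where
  "pg2_points = {P. vec.subspace P \<and> vec.dim P = 1}"

text \<open>The action of a coset of the scalars on a subspace. All representatives of the coset map the
  subspace to the same image, so the union below is that common image.\<close>

definition proj_act :: "('a::field ^ 3 ^ 3) set \<Rightarrow> ('a ^ 3) set \<Rightarrow> ('a ^ 3) set" where
  "proj_act g P = (\<Union>A\<in>g. (*v) A ` P)"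

definition singer_cycle :: "('a::{field,finite} ^ 3 ^ 3) set set \<Rightarrow> bool" where
  "singer_cycle G \<longleftrightarrow> subgroup G PGL3 \<and> cyclic_group (PGL3\<lparr>carrier := G\<rparr>) \<and>
     card G = CARD('a)^2 + CARD('a) + 1 \<and>
     (\<forall>P\<in>pg2_points. \<forall>Q\<in>pg2_points. \<exists>!g. g \<in> G \<and> proj_act g P = Q)"

definition induces_singer_cycle :: "'a::{field,finite} ^ 3 ^ 3 \<Rightarrow> bool" where
  "induces_singer_cycle S \<longleftrightarrow>
     S \<in> carrier GL3 \<and> singer_cycle (generate PGL3 {scalars3 #>\<^bsub>GL3\<^esub> S})"

text \<open>The orbit of a point under \<open>\<langle>S\<rangle> \<le> GL(3, F\<^sub>q)\<close> acting by \<open>xR \<mapsto> (Ax)R\<close>.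
  Scalar matrices need not act trivially on the Barbilian space, so this is in general not an
  action of the image of \<open>S\<close> in \<open>PGL(3, F\<^sub>q)\<close>.\<close>

definition embed_mat :: "('a::field \<Rightarrow> 'a) \<Rightarrow> 'a ^ 3 ^ 3 \<Rightarrow> 'a poly set ^ 3 ^ 3" where
  "embed_mat \<sigma> A = (\<chi> i j. const_emb \<sigma> (A $ i $ j))"

definition orbit_of :: "('a::field \<Rightarrow> 'a) \<Rightarrow> 'a ^ 3 ^ 3 \<Rightarrow>
    ('a poly set ^ 3) set \<Rightarrow> ('a poly set ^ 3) set set" where
  "orbit_of \<sigma> S p = {right_span (chain_ring \<sigma>) (mat_vec (chain_ring \<sigma>) (embed_mat \<sigma> A) x) | A x.
     A \<in> generate GL3 {S} \<and> x \<in> free_module (chain_ring \<sigma>) \<and> p = right_span (chain_ring \<sigma>) x}"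

section \<open>Homogeneous weight and codes\<close>

definition left_ideal_of :: "('r, 'm) ring_scheme \<Rightarrow> 'r \<Rightarrow> 'r set" where
  "left_ideal_of R x = {r \<otimes>\<^bsub>R\<^esub> x | r. r \<in> carrier R}"

definition is_hom_weight :: "('r, 'm) ring_scheme \<Rightarrow> ('r \<Rightarrow> real) \<Rightarrow> bool" where
  "is_hom_weight R w \<longleftrightarrow> w \<in> carrier R \<rightarrow>\<^sub>E {0..} \<and> w \<zero>\<^bsub>R\<^esub> = 0 \<and>
     (\<forall>x\<in>carrier R. \<forall>y\<in>carrier R. left_ideal_of R x = left_ideal_of R y \<longrightarrow> w x = w y) \<and>
     (\<forall>x\<in>carrier R. x \<noteq> \<zero>\<^bsub>R\<^esub> \<longrightarrow>
        (\<Sum>y\<in>left_ideal_of R x. w y) = real (card (left_ideal_of R x)))"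

definition w_hom :: "('r, 'm) ring_scheme \<Rightarrow> 'r \<Rightarrow> real" where
  "w_hom R = (THE w. is_hom_weight R w)"

definition w_hom_vec :: "('r, 'm) ring_scheme \<Rightarrow> 'r ^ 'n \<Rightarrow> real" where
  "w_hom_vec R x = (\<Sum>i\<in>UNIV. w_hom R (x $ i))"

definition linear_code :: "('r, 'm) ring_scheme \<Rightarrow> ('r ^ 'n) set \<Rightarrow> bool" where
  "linear_code R C \<longleftrightarrow> C \<subseteq> free_module R \<and> vzero R \<in> C \<and>
     (\<forall>x\<in>C. \<forall>y\<in>C. vadd R x y \<in> C) \<and> (\<forall>r\<in>carrier R. \<forall>x\<in>C. lscale R r x \<in> C)"

definition two_weight_code ::
    "('r, 'm) ring_scheme \<Rightarrow> ('r ^ 'n) set \<Rightarrow> real \<Rightarrow> real \<Rightarrow> bool" where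
  "two_weight_code R C w1 w2 \<longleftrightarrow> linear_code R C \<and>
     (\<forall>c\<in>C. c \<noteq> vzero R \<longrightarrow> w_hom_vec R c > 0) \<and>
     w1 \<noteq> w2 \<and> w_hom_vec R ` C - {0} = {w1, w2}"

section \<open>Strongly regular graphs\<close>

definition simple_graph :: "'v set \<Rightarrow> ('v \<Rightarrow> 'v \<Rightarrow> bool) \<Rightarrow> bool" where
  "simple_graph V adj \<longleftrightarrow> (\<forall>x\<in>V. \<not> adj x x) \<and> (\<forall>x\<in>V. \<forall>y\<in>V. adj x y \<longrightarrow> adj y x)"

definition strongly_regular ::
    "'v set \<Rightarrow> ('v \<Rightarrow> 'v \<Rightarrow> bool) \<Rightarrow> nat \<Rightarrow> nat \<Rightarrow> nat \<Rightarrow> nat \<Rightarrow> bool" where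
  "strongly_regular V adj N K l m \<longleftrightarrow> finite V \<and> simple_graph V adj \<and> card V = N \<and>
     (\<exists>x\<in>V. \<exists>y\<in>V. adj x y) \<and>
     (\<exists>x\<in>V. \<exists>y\<in>V. x \<noteq> y \<and> \<not> adj x y) \<and>
     (\<forall>x\<in>V. card {y\<in>V. adj x y} = K) \<and>
     (\<forall>x\<in>V. \<forall>y\<in>V. adj x y \<longrightarrow> card {z\<in>V. adj x z \<and> adj y z} = l) \<and>
     (\<forall>x\<in>V. \<forall>y\<in>V. x \<noteq> y \<and> \<not> adj x y \<longrightarrow> card {z\<in>V. adj x z \<and> adj y z} = m)"

end

theory Submission
  imports Defs
begin

text \<open>The proof is elementary counting in \<open>\<F>\<^sup>3\<close> over the field \<open>\<F>\<close> with \<open>q\<close> elements. A column of \<open>Y\<close> is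
  \<open>a\<^sub>j + b\<^sub>j X\<close> with vectors \<open>a\<^sub>j\<close>, \<open>b\<^sub>j\<close> over the field. Every row vector over \<open>R\<close> is \<open>u + \<sigma>(v) X\<close> for
  unique \<open>u\<close>, \<open>v\<close>, and since \<open>X c = \<sigma>(c) X\<close>, entry \<open>j\<close> of its codeword is
  \<open>u\<cdot>a\<^sub>j + \<sigma>(v\<cdot>a\<^sub>j - g\<^sub>j(u)) X\<close>, where \<open>g\<^sub>j(u) = - \<sigma>\<inverse>(u\<cdot>b\<^sub>j)\<close> is additive in \<open>u\<close>. Transitivity of the Singer cycle
  makes every nonzero vector a multiple of some \<open>a\<^sub>j\<close>; as there are \<open>q\<^sup>2 + q + 1\<close> columns, the \<open>a\<^sub>j\<close>
  represent each point of the projective plane once.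

  Let \<open>u \<noteq> 0\<close>. The \<open>q\<^sup>2\<close> entries off the line \<open>u\<cdot>a\<^sub>j = 0\<close> are units. On the \<open>q + 1\<close> positions of the
  line the entry lies in the radical, and it vanishes at \<open>1\<close> or \<open>q + 1\<close> of them by the hypothesis on
  hyperplanes. These alternatives give the weights \<open>q\<^sup>3/(q - 1)\<close> and \<open>q\<^sup>2\<close>; a pair
  \<open>(0, v)\<close> with \<open>v \<noteq> 0\<close> gives the first weight. So no nonzero pair has weight zero, and the codewords
  correspond to the \<open>q\<^sup>6\<close> pairs \<open>(u, v)\<close>. Let \<open>V(u)\<close> be the set \<open>full_lifts u\<close> of those \<open>v\<close> for which all \<open>q + 1\<close>
  entries vanish. Counting zeros over all \<open>v\<close> yields \<open>|V(u)| = q\<close>, and as \<open>V(u)\<close> is stable under translation by \<open>\<F> u\<close> it is a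
  coset of \<open>\<F> u\<close> (\<open>full_lifts_coset\<close>). This makes the degree
  \<open>(q\<^sup>3 - 1) q = q\<^sup>4 - q\<close>.

  The graph is the Cayley graph of \<open>\<F>\<^sup>3 \<times> \<F>\<^sup>3\<close> for the pairs \<open>(u, v)\<close> with \<open>u \<noteq> 0\<close>, \<open>v \<in> V(u)\<close>, so
  \<open>\<lambda>\<close> and \<open>\<mu>\<close> count the ways to write \<open>(u\<^sub>0, v\<^sub>0) \<noteq> 0\<close> as the sum of two such pairs, with first
  components \<open>u\<close> and \<open>u\<^sub>0 - u\<close>.

  \<^item> If \<open>u\<^sub>0 = 0\<close>, then \<open>u\<close> must be one of the \<open>q - 1\<close> nonzero multiples of \<open>v\<^sub>0\<close>, and every \<open>v \<in> V(u)\<close>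
    works (\<open>card_pairs_vertical\<close>).

  \<^item> If \<open>u\<close> is one of the \<open>q - 2\<close> multiples of \<open>u\<^sub>0 \<noteq> 0\<close> other than \<open>0\<close> and \<open>u\<^sub>0\<close>, the lines of \<open>u\<close>,
    \<open>u\<^sub>0 - u\<close> and \<open>u\<^sub>0\<close> coincide, and by additivity of \<open>g\<^sub>j\<close> all \<open>q\<close> elements of \<open>V(u)\<close> work or none,
    according to whether \<open>v\<^sub>0 \<in> V(u\<^sub>0)\<close> (\<open>card_splits_collinear\<close>).

  \<^item> If \<open>u\<close> and \<open>u\<^sub>0\<close> are independent, their lines meet in one point \<open>a\<^sub>j\<close>. The set \<open>V(u) + V(u\<^sub>0 - u)\<close> is a
    coset of \<open>\<F> u + \<F> u\<^sub>0\<close>, and additivity of \<open>g\<^sub>j\<close> shows that \<open>v\<^sub>0\<close> belongs to it iff position \<open>j\<close> is a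
    zero of the codeword of \<open>(u\<^sub>0, v\<^sub>0)\<close> (\<open>card_splits_transversal\<close>). Each such zero accounts for
    \<open>q\<^sup>2 - q\<close> vectors \<open>u\<close>.

  The codeword has \<open>q + 1\<close> zeros on the line of \<open>u\<^sub>0\<close> if \<open>v\<^sub>0 \<in> V(u\<^sub>0)\<close> and one otherwise, hence
  \<open>\<lambda> = (q - 2) q + (q + 1) (q\<^sup>2 - q)\<close> and \<open>\<mu> = q\<^sup>2 - q\<close>.\<close>

section \<open>Strongly regular Cayley graphs\<close>

text \<open>Common neighbours of \<open>x\<close> and \<open>y\<close> correspond via \<open>z \<mapsto> x - z\<close> to the ways of writing \<open>x - y\<close> as a sum of
  two elements of \<open>D\<close>, since \<open>D = - D\<close>.\<close>

lemma strongly_regular_Cayley: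
  fixes D :: "'g::{ab_group_add,finite} set"
  assumes minus: "\<And>d. - d \<in> D \<longleftrightarrow> d \<in> D"
    and D: "0 \<notin> D" "D \<noteq> {}" "\<exists>d. d \<noteq> 0 \<and> d \<notin> D"
    and adjacent: "\<And>d. d \<in> D \<Longrightarrow> card {w \<in> D. d - w \<in> D} = l"
    and distinct: "\<And>d. d \<noteq> 0 \<Longrightarrow> d \<notin> D \<Longrightarrow> card {w \<in> D. d - w \<in> D} = m"
  shows "strongly_regular UNIV (\<lambda>x y. x - y \<in> D) (CARD('g)) (card D) l m"
proof -
  have sym: "y - x \<in> D" if "x - y \<in> D" for x y
    using minus[of "x - y"] that by simp
  have degree: "card {y. x - y \<in> D} = card D" for x
    by (rule bij_betw_same_card[where f = "\<lambda>y. x - y"],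
        rule bij_betw_byWitness[where f' = "\<lambda>y. x - y"]) auto
  have common: "card {z. x - z \<in> D \<and> y - z \<in> D} = card {w \<in> D. (x - y) - w \<in> D}" for x y
    by (rule bij_betw_same_card[where f = "\<lambda>z. x - z"],
        rule bij_betw_byWitness[where f' = "\<lambda>z. x - z"]) (auto dest: sym simp: algebra_simps)
  obtain d e where "d \<in> D" "e \<noteq> 0" "e \<notin> D" using D by blast
  then have "\<exists>x y. x - y \<in> D" "\<exists>x y. x \<noteq> y \<and> x - y \<notin> D"
    by (metis diff_zero)+
  then show ?thesis
    unfolding strongly_regular_def simple_graph_def
    using D(1) by (auto simp: degree common adjacent distinct intro: sym)
qed

lemma strongly_regular_transfer:
  assumes f: "bij_betw f V W"
    and adj: "\<And>x y. x \<in> V \<Longrightarrow> y \<in> V \<Longrightarrow> adj' (f x) (f y) \<longleftrightarrow> adj x y"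
    and srg: "strongly_regular V adj N K l m"
  shows "strongly_regular W adj' N K l m"
proof -
  have W: "W = f ` V" and inj: "inj_on f V"
    using f by (auto simp: bij_betw_def)
  have filter: "card {y \<in> W. P' y} = card {y \<in> V. P y}"
    if "\<And>y. y \<in> V \<Longrightarrow> P' (f y) \<longleftrightarrow> P y" for P P'
  proof -
    have "{y \<in> W. P' y} = f ` {y \<in> V. P y}"
      using that by (auto simp: W)
    moreover have "inj_on f {y \<in> V. P y}"
      using inj by (rule inj_on_subset) auto
    ultimately show ?thesis by (simp add: card_image)
  qed
  have "card {y \<in> W. adj' (f x) y} = card {y \<in> V. adj x y}" if "x \<in> V" for x
    using that by (intro filter) (auto simp: adj)
  moreover have "card {z \<in> W. adj' (f x) z \<and> adj' (f y) z} = card {z \<in> V. adj x z \<and> adj y z}"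
    if "x \<in> V" "y \<in> V" for x y
    using that by (intro filter) (auto simp: adj)
  moreover have "card W = card V"
    using bij_betw_same_card[OF f] by simp
  moreover have "f x = f y \<longleftrightarrow> x = y" if "x \<in> V" "y \<in> V" for x y
    using inj that by (auto dest: inj_onD)
  ultimately show ?thesis
    using srg unfolding strongly_regular_def simple_graph_def W
    by (auto simp: adj)
qed

section \<open>Linear forms over a finite field\<close>

abbreviation dot :: "'a::field ^ 'k \<Rightarrow> 'a ^ 'k \<Rightarrow> 'a" (infix "\<cdot>" 70) where
  "u \<cdot> x \<equiv> scalar_product u x"

lemma dot_add_left: "(u + v) \<cdot> x = u \<cdot> x + v \<cdot> x"
  and dot_add_right: "u \<cdot> (x + y) = u \<cdot> x + u \<cdot> y"
  and dot_diff_left: "(u - v) \<cdot> x = u \<cdot> x - v \<cdot> x"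
  and dot_diff_right: "u \<cdot> (x - y) = u \<cdot> x - u \<cdot> y"
  and dot_scale_left: "(c *s u) \<cdot> x = c * (u \<cdot> x)"
  and dot_scale_right: "u \<cdot> (c *s x) = c * (u \<cdot> x)"
  and dot_zero_left: "0 \<cdot> x = 0"
  and dot_zero_right: "u \<cdot> 0 = 0"
  and dot_minus_left: "(- u) \<cdot> x = - (u \<cdot> x)"
  by (simp_all add: scalar_product_def distrib_left distrib_right left_diff_distrib
      right_diff_distrib sum.distrib sum_subtractf sum_negf sum_distrib_left mult.assoc mult.left_commute)

lemmas dot_linear = dot_add_left dot_add_right dot_diff_left dot_diff_right
  dot_scale_left dot_scale_right dot_zero_left dot_zero_right dot_minus_left

lemma dot_commute: "u \<cdot> x = x \<cdot> u"
  by (simp add: scalar_product_def mult.commute)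

lemma dot_axis: "u \<cdot> axis i c = u $ i * c"
proof -
  have "u \<cdot> axis i c = (\<Sum>k\<in>UNIV. if k = i then u $ k * c else 0)"
    unfolding scalar_product_def by (intro sum.cong) (auto simp: axis_def)
  then show ?thesis by simp
qed

text \<open>The vector with entry \<open>u\<^sub>i\<close> at \<open>k\<close> and \<open>- u\<^sub>k\<close> at \<open>i\<close> is orthogonal to \<open>u\<close>; orthogonality of \<open>w\<close> to
  these vectors, for a fixed \<open>i\<close> with \<open>u\<^sub>i \<noteq> 0\<close>, says that \<open>w\<close> is a multiple of \<open>u\<close>.\<close>

lemma proportional_if_same_zeros:
  assumes "u \<noteq> 0" and zeros: "\<And>x. u \<cdot> x = 0 \<Longrightarrow> w \<cdot> x = 0"
  shows "\<exists>c. w = c *s u"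
proof -
  obtain i where i: "u $ i \<noteq> 0"
    using \<open>u \<noteq> 0\<close> by (auto simp: vec_eq_iff)
  have "u $ i * w $ k = u $ k * w $ i" for k
    using zeros[of "axis k (u $ i) - axis i (u $ k)"]
    by (simp add: dot_linear dot_axis mult.commute)
  then have "w = (w $ i / u $ i) *s u"
    using i by (simp add: vec_eq_iff nonzero_eq_divide_eq mult.commute)
  then show ?thesis ..
qed

lemma card_eq_sum_fibres:
  assumes "finite A"
  shows "card A = (\<Sum>t\<in>(UNIV :: 'b::finite set). card {x \<in> A. f x = t})"
proof -
  have "card A = (\<Sum>t\<in>UNIV. \<Sum>x\<in>{x \<in> A. f x = t}. 1)"
    using assms by (subst sum.group) auto
  then show ?thesis by simp
qed

text \<open>Translation by a multiple of \<open>z\<close> maps any fibre onto any other, so a functional that does not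
  vanish on \<open>U\<close> takes every value equally often there.\<close>

lemma card_linear_fibre:
  fixes f :: "'a::{field,finite} ^ 'k \<Rightarrow> 'a"
  assumes add: "\<And>x y. x \<in> U \<Longrightarrow> y \<in> U \<Longrightarrow> x + y \<in> U"
    and scale: "\<And>c x. x \<in> U \<Longrightarrow> c *s x \<in> U"
    and f_add: "\<And>x y. f (x + y) = f x + f y"
    and f_scale: "\<And>c x. f (c *s x) = c * f x"
    and nonzero: "z \<in> U" "f z \<noteq> 0"
  shows "card U = CARD('a) * card {x \<in> U. f x = t}"
proof -
  have same: "card {x \<in> U. f x = s} = card {x \<in> U. f x = t}" for s
  proof -
    define d where "d = ((t - s) / f z) *s z"
    have d: "d \<in> U" "- d \<in> U" "f d = t - s" "f (- d) = s - t"
      using nonzero scale[of z "(t - s) / f z"] scale[of z "- ((t - s) / f z)"]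
        f_scale[of "(t - s) / f z" z] f_scale[of "- ((t - s) / f z)" z]
      by (simp_all add: d_def vector_sneg_minus1)
    have "bij_betw (\<lambda>x. x + d) {x \<in> U. f x = s} {x \<in> U. f x = t}"
      by (rule bij_betw_byWitness[where f' = "\<lambda>x. x + - d"])
        (use d add in \<open>auto simp: f_add simp del: add_uminus_conv_diff\<close>)
    then show ?thesis by (rule bij_betw_same_card)
  qed
  have "card U = (\<Sum>s\<in>(UNIV :: 'a set). card {x \<in> U. f x = t})"
    unfolding card_eq_sum_fibres[of U f, simplified] by (intro sum.cong refl same)
  then show ?thesis by simp
qed

lemma card_affine_plane:
  fixes u :: "'a::{field,finite} ^ 3"
  assumes "u \<noteq> 0"
  shows "card {x. u \<cdot> x = t} = CARD('a)\<^sup>2"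
proof -
  obtain i where i: "u $ i \<noteq> 0"
    using assms by (auto simp: vec_eq_iff)
  have "CARD('a ^ 3) = CARD('a) * card {x \<in> UNIV. u \<cdot> x = t}"
    by (rule card_linear_fibre[where z = "axis i 1"]) (use i in \<open>auto simp: dot_linear dot_axis\<close>)
  then show ?thesis by (simp add: power3_eq_cube power2_eq_square)
qed

lemma card_perp_two:
  fixes u w :: "'a::{field,finite} ^ 3"
  assumes "u \<noteq> 0" "\<nexists>c. w = c *s u"
  shows "card {x. u \<cdot> x = 0 \<and> w \<cdot> x = 0} = CARD('a)"
proof -
  obtain z where z: "u \<cdot> z = 0" "w \<cdot> z \<noteq> 0"
    using proportional_if_same_zeros assms by blast
  have "card {x. u \<cdot> x = 0} = CARD('a) * card {x \<in> {x. u \<cdot> x = 0}. w \<cdot> x = 0}"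
    by (rule card_linear_fibre[where z = z]) (use z in \<open>auto simp: dot_linear\<close>)
  then show ?thesis
    by (simp add: card_affine_plane[OF assms(1)] power2_eq_square)
qed

lemma card_multiples:
  fixes u :: "'a::{field,finite} ^ 'k"
  assumes "u \<noteq> 0"
  shows "card (range (\<lambda>c. c *s u)) = CARD('a)"
  using assms by (simp add: card_image inj_on_def)

lemma inj_combination:
  fixes u w :: "'a::field ^ 'k"
  assumes "u \<noteq> 0" "\<nexists>c. w = c *s u"
  shows "inj (\<lambda>(c, d). c *s u + d *s w)"
proof -
  have "c = c' \<and> d = d'" if eq: "c *s u + d *s w = c' *s u + d' *s w" for c d c' d'
  proof -
    have comp: "(d - d') * w $ k = (c' - c) * u $ k" for k
      using arg_cong[OF eq, of "\<lambda>x. x $ k"] by (simp add: algebra_simps)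
    have "d = d'"
    proof (rule ccontr)
      assume "d \<noteq> d'"
      then have "w $ k = (c' - c) / (d - d') * u $ k" for k
        using comp[of k] by (simp add: divide_simps mult.commute)
      then have "w = ((c' - c) / (d - d')) *s u"
        by (simp add: vec_eq_iff)
      with assms show False by blast
    qed
    moreover from this comp have "(c' - c) * u $ k = 0" for k
      by (metis diff_self mult_zero_left)
    ultimately show ?thesis
      using \<open>u \<noteq> 0\<close> by (auto simp: vec_eq_iff)
  qed
  then show ?thesis
    unfolding inj_def by clarsimp
qed

text \<open>In dimension three the span of \<open>u\<close> and \<open>w\<close> is all of \<open>x\<^sup>\<bottom>\<close>, as it is contained in \<open>x\<^sup>\<bottom>\<close> and both sets
  have \<open>q\<^sup>2\<close> elements.\<close>

lemma combination_iff:
  fixes u w :: "'a::{field,finite} ^ 3"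
  assumes indep: "u \<noteq> 0" "\<nexists>c. w = c *s u"
    and x: "x \<noteq> 0" "u \<cdot> x = 0" "w \<cdot> x = 0"
  shows "(\<exists>c d. v = c *s u + d *s w) \<longleftrightarrow> v \<cdot> x = 0"
proof -
  let ?f = "\<lambda>(c, d). c *s u + d *s w"
  have "range ?f \<subseteq> {v. x \<cdot> v = 0}"
    using x by (auto simp: dot_linear dot_commute[of x])
  moreover have "card (range ?f) = card {v. x \<cdot> v = 0}"
    using card_image[OF inj_combination[OF indep]] x(1)
    by (simp add: card_affine_plane power2_eq_square flip: UNIV_Times_UNIV)
  ultimately have "range ?f = {v. x \<cdot> v = 0}"
    by (intro card_subset_eq) auto
  then have "v \<in> range ?f \<longleftrightarrow> v \<cdot> x = 0" 
    by (simp add: dot_commute)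
  then show ?thesis by (auto simp: image_iff)
qed

section \<open>The connection set and its convolution square\<close>

lemma sum_card_filter_swap:
  assumes "finite A" "finite B"
  shows "(\<Sum>x\<in>A. card {y \<in> B. P x y}) = (\<Sum>y\<in>B. card {x \<in> A. P x y})"
  using sum.swap[of "\<lambda>x y. if P x y then 1 else 0 :: nat" B A] assms
  by (simp add: sum.If_cases Int_def)

text \<open>The configuration seen by the codewords: \<open>a\<close> lists representatives of the points of the plane, and
  position \<open>j\<close> is a zero of the codeword of \<open>(u, v)\<close> iff \<open>u\<cdot>a\<^sub>j = 0\<close> and \<open>v\<cdot>a\<^sub>j = g\<^sub>j(u)\<close>. The automorphism
  \<open>\<sigma>\<close> and the radical parts of the columns enter only through the additive maps \<open>g\<^sub>j\<close>. The last
  assumption is the intersection property of the hyperplanes.\<close>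

locale secant_lift =
  fixes q :: nat
    and a :: "'n::finite \<Rightarrow> 'a::{field,finite} ^ 3"
    and g :: "'n \<Rightarrow> 'a ^ 3 \<Rightarrow> 'a"
  assumes q_eq: "q = CARD('a)"
    and card_index: "CARD('n) = q\<^sup>2 + q + 1"
    and cover: "w \<noteq> 0 \<Longrightarrow> \<exists>j c. w = c *s a j"
    and g_add: "g j (x + y) = g j x + g j y"
    and secant: "u \<noteq> 0 \<Longrightarrow> card {j. u \<cdot> a j = 0 \<and> v \<cdot> a j = g j u} \<in> {1, q + 1}"
begin

lemma q_ge_2: "q \<ge> 2"
proof -
  have "card {0, 1 :: 'a} \<le> CARD('a)" by (rule card_mono) auto
  then show ?thesis by (simp add: q_eq)
qed

lemma g_zero: "g j 0 = 0"
  using g_add[of j 0 0] by (metis add_0 add_left_imp_eq add.right_neutral)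

lemma g_diff: "g j (x - y) = g j x - g j y"
  using g_add[of j "x - y" y] by simp

lemma g_minus: "g j (- x) = - g j x"
  using g_diff[of j 0 x] by (simp add: g_zero)

lemma card_units: "card (- {0 :: 'a}) = q - 1"
  by (simp add: Compl_eq_Diff_UNIV card_Diff_subset q_eq)

text \<open>Surjectivity is the covering assumption. Both sets have \<open>(q\<^sup>2 + q + 1) (q - 1) = q\<^sup>3 - 1\<close> elements, so
  injectivity, the uniqueness of representatives, comes for free.\<close>

lemma representatives_bij: "bij_betw (\<lambda>(j, c). c *s a j) (UNIV \<times> - {0}) (- {0})"
proof -
  let ?f = "\<lambda>(j, c). c *s a j"
  let ?A = "(UNIV :: 'n set) \<times> - {0 :: 'a}" and ?B = "- {0 :: 'a ^ 3}"
  obtain r where r: "q = Suc r"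
    using q_ge_2 by (cases q) auto
  have "card ?A = (q\<^sup>2 + q + 1) * (q - 1)"
    by (simp only: card_cartesian_product card_units card_index)
  also have "\<dots> = q ^ 3 - 1"
    by (simp add: r power3_eq_cube power2_eq_square algebra_simps)
  also have "\<dots> = card ?B"
    by (simp add: Compl_eq_Diff_UNIV card_Diff_subset q_eq)
  finally have card_eq: "card ?A = card ?B" .
  have "?B \<subseteq> ?f ` ?A"
  proof
    fix w :: "'a ^ 3" assume "w \<in> ?B"
    with cover[of w] obtain j c where "w = c *s a j" "c \<noteq> 0" by force
    then show "w \<in> ?f ` ?A" by (intro image_eqI[where x = "(j, c)"]) auto
  qed
  moreover have "card (?f ` ?A) \<le> card ?B"
    unfolding card_eq[symmetric] by (rule card_image_le) simp
  ultimately have onto: "?f ` ?A = ?B"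
    by (metis card_seteq finite)
  moreover have "inj_on ?f ?A"
    by (rule eq_card_imp_inj_on) (use onto card_eq in simp_all)
  ultimately show ?thesis by (simp add: bij_betw_def)
qed

lemma a_nonzero: "a j \<noteq> 0"
  using bij_betw_apply[OF representatives_bij, of "(j, 1)"] by simp

text \<open>Counting points with a homogeneous property amounts to counting vectors, each point carrying
  \<open>q - 1\<close> of them.\<close>

lemma card_representatives:
  assumes "\<And>c x. c \<noteq> 0 \<Longrightarrow> P (c *s x) \<longleftrightarrow> P x"
  shows "card {j. P (a j)} * (q - 1) = card ({x. P x} - {0})"
proof -
  have "bij_betw (\<lambda>(j, c). c *s a j) ({j. P (a j)} \<times> - {0}) ({x. P x} - {0})"
  proof (rule bij_betw_subset[OF representatives_bij])
    show "(\<lambda>(j, c). c *s a j) ` ({j. P (a j)} \<times> - {0}) = {x. P x} - {0}" (is "?L = ?R")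
    proof (intro equalityI subsetI)
      fix x assume x: "x \<in> ?R"
      then obtain j c where "x = c *s a j" "c \<noteq> 0" using cover[of x] by force
      with x assms show "x \<in> ?L" by (auto intro!: image_eqI[where x = "(j, c)"])
    qed (use assms a_nonzero in auto)
  qed auto
  then show ?thesis
    by (auto dest: bij_betw_same_card simp: card_cartesian_product card_units)
qed

lemma card_line:
  assumes "u \<noteq> 0"
  shows "card {j. u \<cdot> a j = 0} = q + 1"
proof -
  obtain r where r: "q = Suc (Suc r)"
    using q_ge_2 by (metis add_2_eq_Suc le_Suc_ex)
  have "card {j. u \<cdot> a j = 0} * (q - 1) = card ({x. u \<cdot> x = 0} - {0})"
    by (rule card_representatives) (simp add: dot_linear)
  also have "\<dots> = q\<^sup>2 - 1"
    by (simp add: card_Diff_singleton dot_linear card_affine_plane[OF assms] q_eq)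
  also have "\<dots> = (q + 1) * (q - 1)"
    by (simp add: r power2_eq_square)
  finally show ?thesis
    by (simp add: r del: mult_Suc mult_Suc_right)
qed

lemma card_common_point:
  assumes "u \<noteq> 0" "\<nexists>c. w = c *s u"
  shows "card {j. u \<cdot> a j = 0 \<and> w \<cdot> a j = 0} = 1"
proof -
  have "card {j. u \<cdot> a j = 0 \<and> w \<cdot> a j = 0} * (q - 1) =
      card ({x. u \<cdot> x = 0 \<and> w \<cdot> x = 0} - {0})"
    by (rule card_representatives) (simp add: dot_linear)
  also have "\<dots> = q - 1"
    by (simp add: card_Diff_singleton dot_linear card_perp_two[OF assms] q_eq)
  finally show ?thesis
    using q_ge_2 by simp
qed

text \<open>These \<open>v\<close> lift the line of \<open>u\<close> to a hyperplane meeting the point set in \<open>q + 1\<close> points, the lifts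
  of all points of that line.\<close>

definition full_lifts :: "'a ^ 3 \<Rightarrow> ('a ^ 3) set" where
  "full_lifts u = {v. \<forall>j. u \<cdot> a j = 0 \<longrightarrow> v \<cdot> a j = g j u}"

lemma full_lifts_iff_card:
  assumes "u \<noteq> 0"
  shows "v \<in> full_lifts u \<longleftrightarrow> card {j. u \<cdot> a j = 0 \<and> v \<cdot> a j = g j u} = q + 1"
proof
  assume "v \<in> full_lifts u"
  then have "{j. u \<cdot> a j = 0 \<and> v \<cdot> a j = g j u} = {j. u \<cdot> a j = 0}"
    by (auto simp: full_lifts_def)
  then show "card {j. u \<cdot> a j = 0 \<and> v \<cdot> a j = g j u} = q + 1"
    by (simp add: card_line[OF assms])
next
  assume "card {j. u \<cdot> a j = 0 \<and> v \<cdot> a j = g j u} = q + 1"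
  then have "{j. u \<cdot> a j = 0 \<and> v \<cdot> a j = g j u} = {j. u \<cdot> a j = 0}"
    by (intro card_subset_eq) (auto simp: card_line[OF assms])
  then show "v \<in> full_lifts u"
    by (auto simp: full_lifts_def)
qed

lemma card_zeros:
  assumes "u \<noteq> 0"
  shows "card {j. u \<cdot> a j = 0 \<and> v \<cdot> a j = g j u} = (if v \<in> full_lifts u then q + 1 else 1)"
  using secant[OF assms, of v] full_lifts_iff_card[OF assms, of v] by auto

text \<open>Double counting of the pairs \<open>(v, j)\<close> with \<open>j\<close> a zero on the line of \<open>u\<close>. Each of the \<open>q + 1\<close> positions
  occurs for \<open>q\<^sup>2\<close> vectors \<open>v\<close>; each \<open>v\<close> contributes \<open>1\<close>, or \<open>q + 1\<close> if it is a full lift. Hence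
  \<open>(q + 1) q\<^sup>2 = q\<^sup>3 + q n\<close> for the number \<open>n\<close> of full lifts.\<close>

lemma card_full_lifts:
  assumes "u \<noteq> 0"
  shows "card (full_lifts u) = q"
proof -
  let ?J = "{j. u \<cdot> a j = 0}"
  have "(\<Sum>v\<in>UNIV. card {j \<in> ?J. v \<cdot> a j = g j u}) =
      (\<Sum>j\<in>?J. card {v \<in> UNIV. v \<cdot> a j = g j u})"
    by (rule sum_card_filter_swap) auto
  also have "\<dots> = (q + 1) * q\<^sup>2"
    using card_affine_plane[OF a_nonzero] card_line[OF assms]
    by (simp add: dot_commute[where x = "a j" for j] q_eq)
  also have "(\<Sum>v\<in>UNIV. card {j \<in> ?J. v \<cdot> a j = g j u}) =
      (\<Sum>v\<in>UNIV. 1 + (if v \<in> full_lifts u then q else 0))"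
    by (intro sum.cong) (auto simp: card_zeros[OF assms])
  also have "\<dots> = (\<Sum>v\<in>(UNIV :: ('a ^ 3) set). 1) + (\<Sum>v\<in>UNIV. if v \<in> full_lifts u then q else 0)"
    by (rule sum.distrib)
  also have "\<dots> = q ^ 3 + q * card (full_lifts u)"
    by (simp add: sum.If_cases q_eq)
  finally have "q * card (full_lifts u) = q * q"
    by (simp add: algebra_simps power3_eq_cube power2_eq_square)
  then show ?thesis
    using q_ge_2 by simp
qed

lemma full_lifts_coset:
  assumes "u \<noteq> 0" "v \<in> full_lifts u"
  shows "full_lifts u = range (\<lambda>c. v + c *s u)"
proof (rule card_subset_eq[symmetric])
  show "range (\<lambda>c. v + c *s u) \<subseteq> full_lifts u"
    using assms(2) by (auto simp: full_lifts_def dot_linear)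
  show "card (range (\<lambda>c. v + c *s u)) = card (full_lifts u)"
    using assms(1) by (simp add: card_full_lifts card_image inj_on_def q_eq)
qed simp

lemma full_lifts_nonempty: "u \<noteq> 0 \<Longrightarrow> \<exists>v. v \<in> full_lifts u"
  using card_full_lifts[of u] q_ge_2 by (cases "full_lifts u = {}") auto

lemma full_lifts_minus_iff: "- v \<in> full_lifts (- u) \<longleftrightarrow> v \<in> full_lifts u"
  by (auto simp: full_lifts_def dot_linear g_minus)

definition connection :: "(('a ^ 3) \<times> ('a ^ 3)) set" where
  "connection = {(u, v). u \<noteq> 0 \<and> v \<in> full_lifts u}"

lemma connection_minus_iff: "- d \<in> connection \<longleftrightarrow> d \<in> connection"
  by (cases d) (simp add: connection_def full_lifts_minus_iff)

lemma card_connection: "card connection = q ^ 4 - q"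
proof -
  have "connection = (SIGMA u:- {0}. full_lifts u)"
    by (auto simp: connection_def)
  then have "card connection = (\<Sum>u\<in>- {0}. card (full_lifts u))"
    by (simp add: card_SigmaI)
  also have "\<dots> = (q ^ 3 - 1) * q"
    by (simp add: card_full_lifts Compl_eq_Diff_UNIV card_Diff_subset q_eq)
  also have "\<dots> = q ^ 4 - q"
    by (simp add: diff_mult_distrib eval_nat_numeral)
  finally show ?thesis .
qed

text \<open>Those \<open>v\<close> for which \<open>(u, v)\<close> and \<open>(u0 - u, v0 - v)\<close> both belong to the connection set, provided that
  \<open>u\<close> is neither \<open>0\<close> nor \<open>u0\<close>.\<close>

definition splits :: "'a ^ 3 \<Rightarrow> 'a ^ 3 \<Rightarrow> 'a ^ 3 \<Rightarrow> ('a ^ 3) set" where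
  "splits u0 v0 u = {v \<in> full_lifts u. v0 - v \<in> full_lifts (u0 - u)}"

lemma card_connection_pairs:
  "card {w \<in> connection. (u0, v0) - w \<in> connection} = (\<Sum>u\<in>- {0, u0}. card (splits u0 v0 u))"
proof -
  have "{w \<in> connection. (u0, v0) - w \<in> connection} = (SIGMA u:- {0, u0}. splits u0 v0 u)"
    by (auto simp: connection_def splits_def)
  then show ?thesis by (simp add: card_SigmaI)
qed

text \<open>Negation maps full lifts of \<open>- u\<close> to full lifts of \<open>u\<close>, so \<open>v\<close> and \<open>v - v0\<close> must lie in the same coset
  of the multiples of \<open>u\<close>. This means that \<open>v0\<close> is a multiple of \<open>u\<close>.\<close>

lemma card_pairs_vertical:
  assumes "v0 \<noteq> 0"
  shows "card {w \<in> connection. (0, v0) - w \<in> connection} = q\<^sup>2 - q"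
proof -
  let ?L = "range (\<lambda>c. c *s v0)"
  have "card (splits 0 v0 u) = (if u \<in> ?L then q else 0)" if "u \<noteq> 0" for u
  proof -
    have "v0 - v \<in> full_lifts (0 - u) \<longleftrightarrow> u \<in> ?L" if v: "v \<in> full_lifts u" for v
    proof -
      have "v0 - v \<in> full_lifts (0 - u) \<longleftrightarrow> v - v0 \<in> full_lifts u"
        using full_lifts_minus_iff[of "v - v0" u] by simp
      also have "\<dots> \<longleftrightarrow> (\<exists>c. - v0 = c *s u)"
        unfolding full_lifts_coset[OF \<open>u \<noteq> 0\<close> v]
        by (simp add: image_iff diff_conv_add_uminus del: add_uminus_conv_diff)
      also have "\<dots> \<longleftrightarrow> u \<in> ?L"
      proof
        assume "\<exists>c. - v0 = c *s u"
        then obtain c where c: "- v0 = c *s u" by blast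
        with assms have "c \<noteq> 0" by auto
        then have "u = (- 1 / c) *s v0"
          using arg_cong[OF c, of "\<lambda>x. (- 1 / c) *s x"] by (simp add: vector_smult_assoc vec_eq_iff)
        then show "u \<in> ?L" by blast
      next
        assume "u \<in> ?L"
        then obtain c where c: "u = c *s v0" by blast
        with \<open>u \<noteq> 0\<close> have "- v0 = (- 1 / c) *s u"
          by (auto simp: vec_eq_iff)
        then show "\<exists>c. - v0 = c *s u" by blast
      qed
      finally show ?thesis .
    qed
    then have "splits 0 v0 u = (if u \<in> ?L then full_lifts u else {})"
      by (auto simp: splits_def)
    then show ?thesis using card_full_lifts[OF that] by simp
  qed
  then have "(\<Sum>u\<in>- {0, 0}. card (splits 0 v0 u)) = (\<Sum>u\<in>- {0}. if u \<in> ?L then q else 0)"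
    by (intro sum.cong) auto
  also have "\<dots> = q * card (?L - {0})"
    by (simp add: sum.If_cases Diff_eq Int_commute)
  also have "card (?L - {0}) = q - 1"
  proof -
    have "0 \<in> ?L" by (auto intro: image_eqI[where x = 0])
    then show ?thesis using card_multiples[OF assms] by (simp add: card_Diff_singleton q_eq)
  qed
  finally show ?thesis
    by (simp only: card_connection_pairs) (simp add: diff_mult_distrib2 power2_eq_square)
qed

text \<open>The vectors \<open>u0\<close>, \<open>c u0\<close> and \<open>(1 - c) u0\<close> define the same line. On it the conditions for \<open>v\<close> and
  \<open>v0 - v\<close> add up to the condition for \<open>v0\<close> because each \<open>g j\<close> is additive.\<close>

lemma card_splits_collinear:
  assumes "c \<noteq> 0" "c \<noteq> 1" "u0 \<noteq> 0"
  shows "card (splits u0 v0 (c *s u0)) = (if v0 \<in> full_lifts u0 then q else 0)"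
proof -
  have rest: "u0 - c *s u0 = (1 - c) *s u0"
    by (simp add: vec.scale_left_diff_distrib)
  have zeros: "(c *s u0) \<cdot> x = 0 \<longleftrightarrow> u0 \<cdot> x = 0" "(u0 - c *s u0) \<cdot> x = 0 \<longleftrightarrow> u0 \<cdot> x = 0" for x
    using assms unfolding rest by (simp_all add: dot_linear)
  have "v0 - v \<in> full_lifts (u0 - c *s u0) \<longleftrightarrow> v0 \<in> full_lifts u0" if "v \<in> full_lifts (c *s u0)" for v
  proof -
    have "(v0 - v) \<cdot> a j = g j (u0 - c *s u0) \<longleftrightarrow> v0 \<cdot> a j = g j u0" if "u0 \<cdot> a j = 0" for j
      using \<open>v \<in> full_lifts (c *s u0)\<close> that by (simp add: full_lifts_def zeros(1) g_diff dot_diff_left)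
    then show ?thesis
      unfolding full_lifts_def mem_Collect_eq zeros by blast
  qed
  then have "splits u0 v0 (c *s u0) = (if v0 \<in> full_lifts u0 then full_lifts (c *s u0) else {})"
    by (auto simp: splits_def)
  then show ?thesis using assms by (simp add: card_full_lifts)
qed

text \<open>Full lifts of \<open>u\<close> and of \<open>u0 - u\<close> form cosets \<open>v1 + \<F> u\<close> and \<open>v2 + \<F> (u0 - u)\<close>, so a splitting is a
  representation of \<open>v0 - v1 - v2\<close> as a combination of \<open>u\<close> and \<open>u0 - u\<close>. It is unique if it exists, and
  it exists iff \<open>v0 - v1 - v2\<close> is orthogonal to the common point \<open>a j\<close> of the two lines. There
  \<open>v1\<close> and \<open>v2\<close> take the values \<open>g j u\<close> and \<open>g j (u0 - u)\<close>, whose sum is \<open>g j u0\<close>. The right-hand side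
  writes the resulting \<open>0\<close> or \<open>1\<close> as a cardinality, ready for summation over \<open>u\<close>.\<close>

lemma card_splits_transversal:
  assumes "u0 \<noteq> 0" and indep: "\<nexists>c. u = c *s u0"
  shows "card (splits u0 v0 u) = card {j. (u0 \<cdot> a j = 0 \<and> v0 \<cdot> a j = g j u0) \<and> u \<cdot> a j = 0}"
proof -
  obtain j where j: "{j. u0 \<cdot> a j = 0 \<and> u \<cdot> a j = 0} = {j}"
    using card_common_point[OF assms] by (meson card_1_singletonE)
  then have perp: "u0 \<cdot> a j = 0" "u \<cdot> a j = 0" by blast+
  have "u \<noteq> 0" using indep by (metis vector_smult_lzero)
  have indep': "\<nexists>c. u0 = c *s u"
  proof
    assume "\<exists>c. u0 = c *s u"
    then obtain c where c: "u0 = c *s u" by blast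
    with \<open>u0 \<noteq> 0\<close> have "u = (1 / c) *s u0" by (auto simp: vector_smult_assoc)
    with indep show False by blast
  qed
  have indep2: "\<nexists>c. u0 - u = c *s u"
  proof
    assume "\<exists>c. u0 - u = c *s u"
    then obtain c where "u0 - u = c *s u" by blast
    then have "u0 = (c + 1) *s u"
      by (simp add: algebra_simps vec.scale_left_distrib)
    with indep' show False by blast
  qed
  then have "u0 - u \<noteq> 0" by (metis vector_smult_lzero)
  obtain v1 v2 where v1: "v1 \<in> full_lifts u" and v2: "v2 \<in> full_lifts (u0 - u)"
    using full_lifts_nonempty \<open>u \<noteq> 0\<close> \<open>u0 - u \<noteq> 0\<close> by meson
  have at_j: "v1 \<cdot> a j + v2 \<cdot> a j = g j u0"
    using v1 v2 perp by (simp add: full_lifts_def dot_linear g_diff)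
  let ?P = "\<lambda>c d. v0 - v1 - v2 = c *s u + d *s (u0 - u)"
  have splits_eq: "splits u0 v0 u = {v1 + c *s u | c. \<exists>d. ?P c d}"
  proof -
    have "v0 - (v1 + c *s u) = v2 + d *s (u0 - u) \<longleftrightarrow> ?P c d" for c d
      by (auto simp: algebra_simps)
    then show ?thesis
      unfolding splits_def full_lifts_coset[OF \<open>u \<noteq> 0\<close> v1] full_lifts_coset[OF \<open>u0 - u \<noteq> 0\<close> v2]
      by (auto simp: image_iff)
  qed
  have "(\<exists>c d. ?P c d) \<longleftrightarrow> (v0 - v1 - v2) \<cdot> a j = 0"
    by (rule combination_iff[OF \<open>u \<noteq> 0\<close> indep2 a_nonzero]) (use perp in \<open>simp_all add: dot_linear\<close>)
  also have "\<dots> \<longleftrightarrow> v0 \<cdot> a j = g j u0"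
    using at_j by (auto simp: dot_linear algebra_simps)
  finally have ex: "(\<exists>c d. ?P c d) \<longleftrightarrow> v0 \<cdot> a j = g j u0" .
  have unique: "c = c'" if "?P c d" "?P c' d'" for c d c' d'
    using injD[OF inj_combination[OF \<open>u \<noteq> 0\<close> indep2], of "(c, d)" "(c', d')"] that by simp
  show ?thesis
  proof (cases "v0 \<cdot> a j = g j u0")
    case True
    with ex obtain c d where "?P c d" by blast
    with unique have "splits u0 v0 u = {v1 + c *s u}"
      unfolding splits_eq by blast
    moreover from True j have "{j. (u0 \<cdot> a j = 0 \<and> v0 \<cdot> a j = g j u0) \<and> u \<cdot> a j = 0} = {j}"
      by blast
    ultimately show ?thesis by simp
  next
    case False
    with ex have "splits u0 v0 u = {}"
      unfolding splits_eq by blast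
    moreover from False j have "{j. (u0 \<cdot> a j = 0 \<and> v0 \<cdot> a j = g j u0) \<and> u \<cdot> a j = 0} = {}"
      by (auto dest: equalityD1)
    ultimately show ?thesis by simp
  qed
qed

text \<open>The sum over \<open>u\<close> is split into multiples of \<open>u0\<close> and independent \<open>u\<close>. For the latter the order of
  summation is exchanged: a zero \<open>j\<close> of the codeword is counted once for each \<open>u\<close> outside \<open>\<F> u0\<close> with
  \<open>u \<cdot> a j = 0\<close>.\<close>

lemma card_pairs_general:
  assumes "u0 \<noteq> 0"
  shows "card {w \<in> connection. (u0, v0) - w \<in> connection} =
    (if v0 \<in> full_lifts u0 then q ^ 3 + q\<^sup>2 - 3 * q else q\<^sup>2 - q)"
proof -
  let ?L = "range (\<lambda>c. c *s u0)"
  let ?Z = "{j. u0 \<cdot> a j = 0 \<and> v0 \<cdot> a j = g j u0}"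
  have card_L: "card ?L = q"
    using card_multiples[OF assms] by (simp add: q_eq)
  have L_mem: "0 \<in> ?L" "u0 \<in> ?L"
    by (auto intro: image_eqI[where x = 0] image_eqI[where x = 1])
  have "(\<Sum>u\<in>?L - {0, u0}. card (splits u0 v0 u)) =
      (\<Sum>u\<in>?L - {0, u0}. if v0 \<in> full_lifts u0 then q else 0)"
  proof (intro sum.cong refl)
    fix u assume "u \<in> ?L - {0, u0}"
    then obtain c where "u = c *s u0" "c \<noteq> 0" "c \<noteq> 1"
      by (metis (no_types, lifting) DiffE imageE insertCI vector_smult_lid vector_smult_lzero)
    then show "card (splits u0 v0 u) = (if v0 \<in> full_lifts u0 then q else 0)"
      using card_splits_collinear[of c u0 v0] assms by simp
  qed
  also have "\<dots> = (q - 2) * (if v0 \<in> full_lifts u0 then q else 0)"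
    using L_mem assms by (simp add: card_Diff_subset card_L numeral_2_eq_2)
  finally have collinear: "(\<Sum>u\<in>?L - {0, u0}. card (splits u0 v0 u)) = \<dots>" .
  have "(\<Sum>u\<in>- ?L. card (splits u0 v0 u)) = (\<Sum>u\<in>- ?L. card {j \<in> ?Z. u \<cdot> a j = 0})"
    using card_splits_transversal[OF assms] by (intro sum.cong refl) auto
  also have "\<dots> = (\<Sum>j\<in>?Z. card {u \<in> - ?L. u \<cdot> a j = 0})"
    by (rule sum_card_filter_swap) auto
  also have "\<dots> = (\<Sum>j\<in>?Z. q\<^sup>2 - q)"
  proof (intro sum.cong refl)
    fix j assume "j \<in> ?Z"
    then have "?L \<subseteq> {u. a j \<cdot> u = 0}"
      by (auto simp: dot_linear dot_commute[of "a j"])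
    moreover have "{u \<in> - ?L. u \<cdot> a j = 0} = {u. a j \<cdot> u = 0} - ?L"
      by (auto simp: dot_commute)
    ultimately show "card {u \<in> - ?L. u \<cdot> a j = 0} = q\<^sup>2 - q"
      by (simp add: card_Diff_subset card_L card_affine_plane[OF a_nonzero] q_eq)
  qed
  also have "\<dots> = (if v0 \<in> full_lifts u0 then q + 1 else 1) * (q\<^sup>2 - q)"
    by (simp add: card_zeros[OF assms])
  finally have transversal: "(\<Sum>u\<in>- ?L. card (splits u0 v0 u)) = \<dots>" .
  have split: "- {0, u0} = (?L - {0, u0}) \<union> - ?L"
    using L_mem by blast
  have "(\<Sum>u\<in>- {0, u0}. card (splits u0 v0 u)) =
      (\<Sum>u\<in>?L - {0, u0}. card (splits u0 v0 u)) + (\<Sum>u\<in>- ?L. card (splits u0 v0 u))"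
    unfolding split by (rule sum.union_disjoint) auto
  then have total: "card {w \<in> connection. (u0, v0) - w \<in> connection} =
      (q - 2) * (if v0 \<in> full_lifts u0 then q else 0) + (if v0 \<in> full_lifts u0 then q + 1 else 1) * (q\<^sup>2 - q)"
    by (simp only: card_connection_pairs collinear transversal)
  obtain r where r: "q = r + 2"
    using q_ge_2 by (metis add.commute le_Suc_ex)
  show ?thesis
    unfolding total by (simp add: r power3_eq_cube power2_eq_square algebra_simps)
qed

lemma card_off_line:
  assumes "u \<noteq> 0"
  shows "card {j. u \<cdot> a j \<noteq> 0} = q\<^sup>2"
proof -
  have "card (UNIV - {j. u \<cdot> a j = 0}) = q\<^sup>2"
    by (subst card_Diff_subset) (simp_all add: card_line[OF assms] card_index)
  moreover have "UNIV - {j. u \<cdot> a j = 0} = {j. u \<cdot> a j \<noteq> 0}" by auto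
  ultimately show ?thesis by simp
qed

lemma real_q: "real q > 1"
  using q_ge_2 by simp

text \<open>For \<open>u \<noteq> 0\<close> there are \<open>q\<^sup>2\<close> unit entries, and either no or \<open>q\<close> nonzero radical entries; in the second
  case the weight is \<open>q\<^sup>2 + q\<^sup>2/(q - 1) = q\<^sup>3/(q - 1)\<close>. For \<open>u = 0 \<noteq> v\<close> the nonzero entries are the \<open>q\<^sup>2\<close>
  radical ones off the line of \<open>v\<close>, and the weight is \<open>q\<^sup>2 \<cdot> q/(q - 1)\<close>.\<close>

lemma sum_entry_weights:
  "(\<Sum>j\<in>UNIV. if u \<cdot> a j \<noteq> 0 then 1 else if v \<cdot> a j \<noteq> g j u then real q / (real q - 1) else 0) =
    (if (u, v) = (0, 0) then 0
     else if (u, v) \<in> connection then real q ^ 2 else real q ^ 3 / (real q - 1))"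
proof (cases "u = 0")
  case True
  have "(\<Sum>j\<in>UNIV. if v \<cdot> a j \<noteq> 0 then real q / (real q - 1) else 0) =
      card {j. v \<cdot> a j \<noteq> 0} * (real q / (real q - 1))"
    by (simp add: sum.If_cases flip: Collect_neg_eq)
  moreover have "card {j. v \<cdot> a j \<noteq> 0} = (if v = 0 then 0 else q\<^sup>2)"
    by (simp add: card_off_line dot_linear)
  ultimately show ?thesis
    using True by (simp add: dot_linear g_zero connection_def power3_eq_cube power2_eq_square)
next
  case False
  let ?zeros = "{j. u \<cdot> a j = 0 \<and> v \<cdot> a j = g j u}"
  let ?radical = "{j. u \<cdot> a j = 0 \<and> v \<cdot> a j \<noteq> g j u}"
  have "?radical = {j. u \<cdot> a j = 0} - ?zeros" by auto
  then have "card ?radical = card {j. u \<cdot> a j = 0} - card ?zeros"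
    by (simp add: card_Diff_subset subset_iff)
  then have radical: "card ?radical = (if v \<in> full_lifts u then 0 else q)"
    by (simp add: card_line[OF False] card_zeros[OF False])
  have "(\<Sum>j\<in>UNIV. if u \<cdot> a j \<noteq> 0 then 1 else if v \<cdot> a j \<noteq> g j u then real q / (real q - 1) else 0) =
      (\<Sum>j\<in>UNIV. (if j \<in> {j. u \<cdot> a j \<noteq> 0} then 1 else 0) +
        (if j \<in> ?radical then real q / (real q - 1) else 0))"
    by (intro sum.cong) auto
  also have "\<dots> = card {j. u \<cdot> a j \<noteq> 0} + card ?radical * (real q / (real q - 1))"
    by (subst sum.distrib, subst (1 2) sum.If_cases) simp_all
  also have "\<dots> = (if v \<in> full_lifts u then real q ^ 2 else real q ^ 3 / (real q - 1))"
    using real_q by (simp add: radical card_off_line[OF False] field_simps power3_eq_cube power2_eq_square)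
  finally show ?thesis
    using False by (simp add: connection_def)
qed

lemma connection_srg:
  "strongly_regular UNIV (\<lambda>x y. x - y \<in> connection)
    (q ^ 6) (q ^ 4 - q) (q ^ 3 + q\<^sup>2 - 3 * q) (q\<^sup>2 - q)"
proof -
  obtain d where "d \<in> connection"
  proof -
    obtain v where "v \<in> full_lifts (axis 0 1)" using full_lifts_nonempty[of "axis 0 1"] by auto
    then show ?thesis using that by (force simp: connection_def)
  qed
  have "strongly_regular UNIV (\<lambda>x y. x - y \<in> connection) CARD(('a ^ 3) \<times> ('a ^ 3)) (card connection)
    (q ^ 3 + q\<^sup>2 - 3 * q) (q\<^sup>2 - q)"
  proof (rule strongly_regular_Cayley)
    show "connection \<noteq> {}" using \<open>d \<in> connection\<close> by blast
    show "\<exists>d. d \<noteq> 0 \<and> d \<notin> connection"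
      by (rule exI[of _ "(0, axis 0 1)"]) (simp add: connection_def zero_prod_def)
    show "card {w \<in> connection. d - w \<in> connection} = q ^ 3 + q\<^sup>2 - 3 * q" if "d \<in> connection" for d
      using that card_pairs_general[of "fst d" "snd d"] by (auto simp: connection_def)
    show "card {w \<in> connection. d - w \<in> connection} = q\<^sup>2 - q" if "d \<noteq> 0" "d \<notin> connection" for d
      using that card_pairs_general[of "fst d" "snd d"] card_pairs_vertical[of "snd d"]
      by (cases d; cases "fst d = 0") (simp_all add: connection_def zero_prod_def)
  qed (simp_all add: connection_minus_iff, simp add: connection_def zero_prod_def)
  then show ?thesis
    by (simp add: card_connection flip: q_eq power_add)
qed

end

section \<open>The chain ring in coordinates\<close>

lemma poly_monom_induct:
  assumes monom: "\<And>a n. P (monom a n)" and add: "\<And>f g. P f \<Longrightarrow> P g \<Longrightarrow> P (f + g)"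
  shows "P f"
proof -
  have "P (\<Sum>i\<in>I. monom (coeff f i) i)" if "finite I" for I
    using that by induction (use monom[of 0 0] in \<open>auto intro: monom add\<close>)
  from this[of "{..degree f}"] show ?thesis
    by (simp add: poly_as_sum_of_monoms)
qed

locale skew_chain_ring =
  fixes \<sigma> :: "'a::{field,finite} \<Rightarrow> 'a"
  assumes aut: "field_aut \<sigma>"
begin

lemma \<sigma>_add: "\<sigma> (x + y) = \<sigma> x + \<sigma> y"
  and \<sigma>_mult: "\<sigma> (x * y) = \<sigma> x * \<sigma> y"
  and \<sigma>_bij: "bij \<sigma>"
  using aut by (auto simp: field_aut_def)

lemma \<sigma>_0 [simp]: "\<sigma> 0 = 0"
  using \<sigma>_add[of 0 0] by (metis add_0 add_left_imp_eq add.right_neutral)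

lemma \<sigma>_eq_0_iff [simp]: "\<sigma> x = 0 \<longleftrightarrow> x = 0"
  using \<sigma>_bij by (metis \<sigma>_0 bij_pointE)

lemma \<sigma>_1 [simp]: "\<sigma> 1 = 1"
  using \<sigma>_mult[of 1 1] by simp

lemma \<sigma>_diff: "\<sigma> (x - y) = \<sigma> x - \<sigma> y"
  using \<sigma>_add[of "x - y" y] by simp

lemma \<sigma>_sum: "\<sigma> (sum f A) = (\<Sum>i\<in>A. \<sigma> (f i))"
  by (induction A rule: infinite_finite_induct) (auto simp: \<sigma>_add)

lemma pow_add: "(\<sigma> ^^ i) (x + y) = (\<sigma> ^^ i) x + (\<sigma> ^^ i) y"
  and pow_mult: "(\<sigma> ^^ i) (x * y) = (\<sigma> ^^ i) x * (\<sigma> ^^ i) y"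
  and pow_0: "(\<sigma> ^^ i) 0 = 0"
  and pow_1: "(\<sigma> ^^ i) 1 = 1"
  by (induction i) (simp_all add: \<sigma>_add \<sigma>_mult)

abbreviation skew (infixl "\<star>" 70) where "f \<star> g \<equiv> skew_mult \<sigma> f g"

text \<open>Summands beyond the degrees vanish. The freedom in the bounds puts the summands of a sum of
  polynomials over a common index set, which yields biadditivity.\<close>

lemma skew_mult_bounds:
  assumes "degree f \<le> m" "degree g \<le> k"
  shows "f \<star> g = (\<Sum>i\<le>m. \<Sum>j\<le>k. monom (coeff f i * (\<sigma> ^^ i) (coeff g j)) (i + j))"
proof -
  have "(\<Sum>j\<le>degree g. monom (coeff f i * (\<sigma> ^^ i) (coeff g j)) (i + j)) =
      (\<Sum>j\<le>k. monom (coeff f i * (\<sigma> ^^ i) (coeff g j)) (i + j))" for i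
    by (rule sum.mono_neutral_left) (use assms in \<open>auto simp: coeff_eq_0 pow_0\<close>)
  then show ?thesis
    unfolding skew_mult_def
    by simp (rule sum.mono_neutral_left, use assms in \<open>auto simp: coeff_eq_0\<close>)
qed

lemma skew_mult_add_left: "(f + f') \<star> g = f \<star> g + f' \<star> g"
proof -
  let ?m = "max (degree f) (degree f')"
  have "degree (f + f') \<le> ?m" by (rule degree_add_le_max)
  then show ?thesis
    by (simp add: skew_mult_bounds[where m = ?m and k = "degree g"] sum.distrib distrib_right
        add_monom[symmetric])
qed

lemma skew_mult_add_right: "f \<star> (g + g') = f \<star> g + f \<star> g'"
proof -
  let ?m = "max (degree g) (degree g')"
  have "degree (g + g') \<le> ?m" by (rule degree_add_le_max)
  then show ?thesis
    by (simp add: skew_mult_bounds[where k = ?m and m = "degree f"] sum.distrib distrib_left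
        pow_add add_monom[symmetric])
qed

lemma skew_mult_monom: "monom x i \<star> monom y j = monom (x * (\<sigma> ^^ i) y) (i + j)"
proof -
  have "monom x i \<star> monom y j = (\<Sum>i'\<le>i. \<Sum>j'\<le>j.
      if j' = j then (if i' = i then monom (x * (\<sigma> ^^ i) y) (i + j) else 0) else 0)"
    unfolding skew_mult_bounds[OF degree_monom_le degree_monom_le]
    by (intro sum.cong) (auto simp: pow_0)
  then show ?thesis by simp
qed

text \<open>By biadditivity it suffices to compare monomials, where both sides have coefficient
  \<open>x \<sigma>\<^sup>i(y) \<sigma>\<^sup>i\<^sup>+\<^sup>j(z)\<close>.\<close>

lemma skew_mult_assoc: "(f \<star> g) \<star> h = f \<star> (g \<star> h)"
proof (induction f rule: poly_monom_induct)
  case (1 x i)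
  show ?case
  proof (induction g rule: poly_monom_induct)
    case (1 y j)
    show ?case
      by (induction h rule: poly_monom_induct)
        (simp_all add: skew_mult_monom skew_mult_add_right pow_mult funpow_add mult.assoc add.assoc)
  qed (simp_all add: skew_mult_add_left skew_mult_add_right)
qed (simp_all add: skew_mult_add_left)

lemma skew_mult_one_left: "1 \<star> f = f"
  by (induction f rule: poly_monom_induct)
    (simp_all add: skew_mult_add_right skew_mult_monom flip: monom_eq_1)

lemma skew_mult_one_right: "f \<star> 1 = f"
  by (induction f rule: poly_monom_induct)
    (simp_all add: skew_mult_add_left skew_mult_monom pow_1 flip: monom_eq_1)

abbreviation "P \<equiv> skew_poly_ring \<sigma>"

lemma skew_poly_simps:
  "carrier P = UNIV" "mult P = skew_mult \<sigma>" "one P = 1" "zero P = 0" "add P = (+)"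
  by (simp_all add: skew_poly_ring_def)

lemma ring_skew_poly: "ring P"
proof (rule ringI)
  show "abelian_group P"
    by (rule abelian_groupI) (auto simp: skew_poly_simps intro: exI[of _ "- x" for x])
  show "Group.monoid P"
    by (rule monoidI)
      (auto simp: skew_poly_simps skew_mult_assoc skew_mult_one_left skew_mult_one_right)
qed (auto simp: skew_poly_simps skew_mult_add_left skew_mult_add_right)

lemma skew_poly_a_inv: "a_inv P f = - f"
proof -
  interpret P: ring P by (rule ring_skew_poly)
  show ?thesis
    using P.minus_equality[of "- f" f] by (simp add: skew_poly_simps)
qed

lemma coeff_skew_mult:
  "coeff (f \<star> g) 0 = coeff f 0 * coeff g 0"
  "coeff (f \<star> g) 1 = coeff f 0 * coeff g 1 + coeff f 1 * \<sigma> (coeff g 0)"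
proof -
  have "coeff (f \<star> g) 0 = coeff f 0 * coeff g 0 \<and>
    coeff (f \<star> g) 1 = coeff f 0 * coeff g 1 + coeff f 1 * \<sigma> (coeff g 0)"
  proof (induction f rule: poly_monom_induct)
    case (1 x i)
    show ?case
    proof (induction g rule: poly_monom_induct)
      case (1 y j)
      show ?case
        by (cases i; cases j) (auto simp: skew_mult_monom)
    qed (auto simp: skew_mult_add_right \<sigma>_add algebra_simps)
  qed (auto simp: skew_mult_add_left algebra_simps)
  then show "coeff (f \<star> g) 0 = coeff f 0 * coeff g 0"
    "coeff (f \<star> g) 1 = coeff f 0 * coeff g 1 + coeff f 1 * \<sigma> (coeff g 0)" by auto
qed

lemma skew_mult_X2: "f \<star> monom 1 2 = pCons 0 (pCons 0 f)"
  by (induction f rule: poly_monom_induct)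
    (simp_all add: skew_mult_monom pow_1 skew_mult_add_left flip: monom_Suc)

text \<open>The right-hand side is an ideal containing \<open>X\<^sup>2\<close>. Conversely, \<open>f X\<^sup>2\<close> is \<open>f\<close> shifted by two places, as
  \<open>\<sigma>\<close> fixes \<open>1\<close>; so every element of the right-hand side is already a left multiple of \<open>X\<^sup>2\<close>.\<close>

lemma X2_ideal_eq: "X2_ideal \<sigma> = {f. coeff f 0 = 0 \<and> coeff f 1 = 0}" (is "_ = ?I")
proof
  interpret P: ring P by (rule ring_skew_poly)
  have "subgroup ?I (add_monoid P)"
    by (rule P.add.subgroupI)
      (auto simp: skew_poly_simps skew_poly_a_inv simp flip: a_inv_def intro: exI[of _ 0])
  then have "ideal ?I P"
    by (rule idealI[OF ring_skew_poly]) (auto simp: skew_poly_simps coeff_skew_mult simp del: One_nat_def)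
  then show "X2_ideal \<sigma> \<subseteq> ?I"
    unfolding X2_ideal_def by (rule P.genideal_minimal) simp
  interpret X2: ideal "X2_ideal \<sigma>" P
    unfolding X2_ideal_def by (rule P.genideal_ideal) (simp add: skew_poly_simps)
  show "?I \<subseteq> X2_ideal \<sigma>"
  proof
    fix f assume "f \<in> ?I"
    then have "coeff f 0 = 0" "coeff f 1 = 0" by auto
    then have "f = poly_shift 2 f \<star> monom 1 2"
      unfolding skew_mult_X2
      by (auto simp: poly_eq_iff coeff_pCons coeff_poly_shift numeral_2_eq_2 split: nat.split)
    moreover have "monom 1 2 \<in> X2_ideal \<sigma>"
      unfolding X2_ideal_def using P.genideal_self[of "{monom 1 2}"] by (simp add: skew_poly_simps)
    ultimately show "f \<in> X2_ideal \<sigma>"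
      using X2.I_l_closed[of "monom 1 2" "poly_shift 2 f"] by (simp add: skew_poly_simps)
  qed
qed

lemma X2_ideal: "ideal (X2_ideal \<sigma>) P"
  unfolding X2_ideal_def
  by (rule ring.genideal_ideal[OF ring_skew_poly]) (simp add: skew_poly_simps)

abbreviation "R \<equiv> chain_ring \<sigma>"

definition el :: "'a \<Rightarrow> 'a \<Rightarrow> 'a poly set" where
  "el x y = X2_ideal \<sigma> +>\<^bsub>P\<^esub> [:x, y:]"

lemma coset_eq_iff:
  "X2_ideal \<sigma> +>\<^bsub>P\<^esub> f = X2_ideal \<sigma> +>\<^bsub>P\<^esub> g \<longleftrightarrow> coeff f 0 = coeff g 0 \<and> coeff f 1 = coeff g 1"
  using ring.quotient_eq_iff_same_a_r_cos[OF ring_skew_poly X2_ideal, of f g]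
  by (auto simp: skew_poly_simps a_minus_def skew_poly_a_inv X2_ideal_eq)

lemma coset_eq_el: "X2_ideal \<sigma> +>\<^bsub>P\<^esub> f = el (coeff f 0) (coeff f 1)"
  unfolding el_def coset_eq_iff by simp

lemma el_eq_iff [simp]: "el x y = el x' y' \<longleftrightarrow> x = x' \<and> y = y'"
  unfolding el_def coset_eq_iff by simp

lemma chain_ring_cases:
  assumes "r \<in> carrier R"
  obtains x y where "r = el x y"
  using assms by (auto simp: chain_ring_def FactRing_def A_RCOSETS_def' coset_eq_el)

lemma el_closed [simp]: "el x y \<in> carrier R"
  by (auto simp: chain_ring_def FactRing_def A_RCOSETS_def' skew_poly_simps el_def)

lemma carrier_eq: "carrier R = range (\<lambda>(x, y). el x y)"
  by (auto elim: chain_ring_cases)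

lemma ring_R: "ring R"
  unfolding chain_ring_def by (rule ideal.quotient_is_ring[OF X2_ideal])

lemma el_mult [simp]: "el x y \<otimes>\<^bsub>R\<^esub> el x' y' = el (x * x') (x * y' + y * \<sigma> x')"
  unfolding chain_ring_def FactRing_def el_def
  by (simp add: ideal.rcoset_mult_add[OF X2_ideal] skew_poly_simps)
     (simp add: coset_eq_iff coeff_skew_mult del: One_nat_def, simp)

lemma el_add [simp]: "el x y \<oplus>\<^bsub>R\<^esub> el x' y' = el (x + x') (y + y')"
  unfolding chain_ring_def FactRing_def el_def
  by (simp add: ideal.a_rcos_sum[OF X2_ideal] skew_poly_simps)

lemma el_zero: "\<zero>\<^bsub>R\<^esub> = el 0 0"
proof -
  interpret ring R by (rule ring_R)
  have "el 0 0 \<oplus>\<^bsub>R\<^esub> el 0 0 = el 0 0" by simp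
  then show ?thesis by (metis el_closed add.l_cancel_one)
qed

lemma el_one: "\<one>\<^bsub>R\<^esub> = el 1 0"
  unfolding chain_ring_def FactRing_def el_def
  by (simp add: skew_poly_simps one_pCons coset_eq_iff)

lemma el_minus [simp]: "el x y \<ominus>\<^bsub>R\<^esub> el x' y' = el (x - x') (y - y')"
proof -
  interpret ring R by (rule ring_R)
  have "\<ominus>\<^bsub>R\<^esub> el x' y' = el (- x') (- y')"
    by (rule minus_equality) (simp_all add: el_zero)
  then show ?thesis by (simp add: a_minus_def)
qed

lemma const_emb_el: "const_emb \<sigma> x = el x 0"
  by (simp add: const_emb_def coset_eq_el)

lemma el_finsum: "finite A \<Longrightarrow> (\<Oplus>\<^bsub>R\<^esub>i\<in>A. el (f i) (h i)) = el (sum f A) (sum h A)"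
proof -
  interpret ring R by (rule ring_R)
  show "finite A \<Longrightarrow> ?thesis"
    by (induction A rule: finite_induct) (simp_all add: el_zero)
qed

subsection \<open>The homogeneous weight\<close>

lemma q_gt_1: "CARD('a) > 1"
proof -
  have "card {0, 1 :: 'a} \<le> CARD('a)" by (rule card_mono) auto
  then show ?thesis by simp
qed

text \<open>An element with \<open>x \<noteq> 0\<close> is a unit, and left multiplication by \<open>c + d X\<close> takes \<open>y X\<close> to \<open>c y X\<close>.\<close>

lemma left_ideal_el:
  "left_ideal_of R (el x y) = (if x \<noteq> 0 then carrier R else if y \<noteq> 0 then range (el 0) else {el 0 0})"
proof -
  have "left_ideal_of R (el x y) = range (\<lambda>(c, d). el (c * x) (c * y + d * \<sigma> x))"
    unfolding left_ideal_of_def carrier_eq by force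
  moreover have "el c d \<in> range (\<lambda>(c, d). el (c * x) (c * y + d * \<sigma> x))" if "x \<noteq> 0" for c d
    using that by (intro image_eqI[where x = "(c / x, (d - c / x * y) / \<sigma> x)"]) auto
  moreover have "el 0 d \<in> range (\<lambda>(c, e). el (c * 0) (c * y + e * \<sigma> 0))" if "y \<noteq> 0" for d
    using that by (intro image_eqI[where x = "(d / y, 0)"]) auto
  ultimately show ?thesis
    by (auto simp: carrier_eq)
qed

text \<open>The values of the normalized homogeneous weight, before it is known that the defining conditions
  determine them; \<open>range (el 0)\<close> is the radical.\<close>

definition wt :: "'a poly set \<Rightarrow> real" where
  "wt r = (if r = el 0 0 then 0 else if r \<in> range (el 0) then real CARD('a) / (real CARD('a) - 1) else 1)"

lemma sum_radical: "(\<Sum>r\<in>range (el 0). w r) = (\<Sum>y\<in>UNIV. w (el 0 y))"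
  by (subst sum.reindex) (auto simp: inj_on_def)

lemma sum_carrier: "(\<Sum>r\<in>carrier R. w r) = (\<Sum>x\<in>UNIV. \<Sum>y\<in>UNIV. w (el x y))"
  unfolding carrier_eq
  by (subst sum.reindex) (auto simp: inj_on_def sum.cartesian_product split_def)

lemma card_carrier: "card (carrier R) = CARD('a) * CARD('a)"
  using sum_carrier[of "\<lambda>_. 1 :: nat"] by simp

lemma card_radical: "card (range (el 0)) = CARD('a)"
  by (simp add: card_image inj_on_def)

lemma sum_UNIV_remove: "(\<Sum>x\<in>UNIV. f x) = f 0 + (\<Sum>x\<in>- {0}. f x)" for f :: "'a \<Rightarrow> 'b::comm_monoid_add"
  by (simp add: sum.remove[of UNIV 0] Compl_eq_Diff_UNIV)

lemma real_card_units: "real (card (- {0 :: 'a})) = real CARD('a) - 1"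
  using q_gt_1 by (simp add: Compl_eq_Diff_UNIV card_Diff_subset of_nat_diff)

lemma wt_el: "wt (el x y) = (if x \<noteq> 0 then 1 else if y \<noteq> 0 then real CARD('a) / (real CARD('a) - 1) else 0)"
  by (auto simp: wt_def)

lemma sum_wt_radical: "(\<Sum>y\<in>UNIV. wt (el 0 y)) = CARD('a)"
  using q_gt_1 real_card_units by (simp add: sum_UNIV_remove wt_el)

lemma hom_weight_exists: "is_hom_weight R (\<lambda>r\<in>carrier R. wt r)"
  unfolding is_hom_weight_def
proof (intro conjI ballI impI)
  show "restrict wt (carrier R) \<in> carrier R \<rightarrow>\<^sub>E {0..}"
    using q_gt_1 by (auto simp: wt_def)
  show "restrict wt (carrier R) \<zero>\<^bsub>R\<^esub> = 0"
    by (simp add: el_zero wt_el)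
next
  fix r s assume "r \<in> carrier R" "s \<in> carrier R" and eq: "left_ideal_of R r = left_ideal_of R s"
  then obtain x y x' y' where rs: "r = el x y" "s = el x' y'" by (metis chain_ring_cases)
  have "el 1 0 \<in> left_ideal_of R (el c d) \<longleftrightarrow> c \<noteq> 0"
    "el 0 1 \<in> left_ideal_of R (el c d) \<longleftrightarrow> c \<noteq> 0 \<or> d \<noteq> 0" for c d
    by (auto simp: left_ideal_el)
  with eq have "x \<noteq> 0 \<longleftrightarrow> x' \<noteq> 0" "x \<noteq> 0 \<or> y \<noteq> 0 \<longleftrightarrow> x' \<noteq> 0 \<or> y' \<noteq> 0"
    unfolding rs by metis+
  then show "restrict wt (carrier R) r = restrict wt (carrier R) s"
    by (auto simp: rs wt_el)
next
  fix r assume "r \<in> carrier R" "r \<noteq> \<zero>\<^bsub>R\<^esub>"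
  then obtain x y where r: "r = el x y" "(x, y) \<noteq> (0, 0)" by (metis chain_ring_cases el_zero prod.inject)
  show "(\<Sum>y\<in>left_ideal_of R r. restrict wt (carrier R) y) = real (card (left_ideal_of R r))"
  proof (cases "x = 0")
    case True
    then show ?thesis
      using r by (simp add: left_ideal_el sum_radical card_radical sum_wt_radical)
  next
    case False
    have "(\<Sum>r\<in>carrier R. wt r) = CARD('a) + (\<Sum>x\<in>- {0 :: 'a}. CARD('a))"
      unfolding sum_carrier sum_UNIV_remove[of "\<lambda>x. \<Sum>y\<in>UNIV. wt (el x y)"]
      by (simp add: sum_wt_radical) (simp add: wt_el)
    also have "\<dots> = real (card (carrier R))"
      by (simp add: real_card_units card_carrier algebra_simps)
    finally show ?thesis
      using False by (simp add: r left_ideal_el)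
  qed
qed

text \<open>All nonzero elements of the radical generate the same left ideal, the radical, and all units
  generate \<open>R\<close>, so the weight is constant on either set. Normalization on the radical and then on \<open>R\<close>
  determines the two constants.\<close>

lemma hom_weight_unique:
  assumes w: "is_hom_weight R w"
  shows "w = (\<lambda>r\<in>carrier R. wt r)"
proof -
  have same: "w r = w s" if "r \<in> carrier R" "s \<in> carrier R" "left_ideal_of R r = left_ideal_of R s" for r s
    using w that unfolding is_hom_weight_def by blast
  have total: "(\<Sum>s\<in>left_ideal_of R r. w s) = card (left_ideal_of R r)"
    if "r \<in> carrier R" "r \<noteq> el 0 0" for r
    using w that unfolding is_hom_weight_def el_zero by blast
  have zero: "w (el 0 0) = 0"
    using w unfolding is_hom_weight_def el_zero by blast
  have radical: "w (el 0 y) = w (el 0 1)" if "y \<noteq> 0" for y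
    using that by (intro same) (auto simp: left_ideal_el)
  have units: "w (el x y) = w (el 1 0)" if "x \<noteq> 0" for x y
    using that by (intro same) (auto simp: left_ideal_el)
  have sum_radical_w: "(\<Sum>y\<in>UNIV. w (el 0 y)) = CARD('a)"
    using total[of "el 0 1"] by (simp add: left_ideal_el sum_radical card_radical)
  moreover have "(\<Sum>y\<in>- {0}. w (el 0 y)) = (\<Sum>y\<in>- {0 :: 'a}. w (el 0 1))"
    by (intro sum.cong refl radical) simp
  ultimately have "(real CARD('a) - 1) * w (el 0 1) = CARD('a)"
    by (simp add: sum_UNIV_remove zero real_card_units)
  then have w_radical: "w (el 0 1) = real CARD('a) / (real CARD('a) - 1)"
    using q_gt_1 by (simp add: field_simps)
  have "(\<Sum>x\<in>UNIV. \<Sum>y\<in>UNIV. w (el x y)) = real CARD('a) * real CARD('a)"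
    using total[of "el 1 0"] by (simp add: left_ideal_el sum_carrier card_carrier)
  moreover have "(\<Sum>x\<in>- {0}. \<Sum>y\<in>UNIV. w (el x y)) =
      (\<Sum>x\<in>- {0 :: 'a}. \<Sum>y\<in>(UNIV :: 'a set). w (el 1 0))"
    by (intro sum.cong refl units) simp
  ultimately have "real CARD('a) + (real CARD('a) - 1) * (real CARD('a) * w (el 1 0)) =
      real CARD('a) * real CARD('a)"
    unfolding sum_UNIV_remove[of "\<lambda>x. \<Sum>y\<in>UNIV. w (el x y)"]
    by (simp add: sum_radical_w real_card_units)
  then have "(real CARD('a) - 1) * real CARD('a) * (w (el 1 0) - 1) = 0"
    by (simp add: algebra_simps)
  then have w_unit: "w (el 1 0) = 1"
    using q_gt_1 by simp
  have "w (el x y) = wt (el x y)" for x y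
    using zero radical[of y] units[of x y] w_radical w_unit by (cases "x = 0"; cases "y = 0") (simp_all add: wt_el)
  moreover have "w \<in> extensional (carrier R)"
    using w unfolding is_hom_weight_def PiE_def by blast
  ultimately show ?thesis
    by (intro extensionalityI[of _ "carrier R"]) (auto elim: chain_ring_cases)
qed

lemma w_hom_el:
  "w_hom R (el x y) = (if x \<noteq> 0 then 1 else if y \<noteq> 0 then real CARD('a) / (real CARD('a) - 1) else 0)"
proof -
  have "w_hom R = (\<lambda>r\<in>carrier R. wt r)"
    unfolding w_hom_def by (rule the_equality) (auto intro: hom_weight_exists hom_weight_unique)
  then show ?thesis by (simp add: wt_el)
qed

end

section \<open>Points, hyperplanes and rows in coordinates\<close>

context skew_chain_ring
begin

definition vec_el :: "'a ^ 'k \<Rightarrow> 'a ^ 'k \<Rightarrow> 'a poly set ^ 'k" where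
  "vec_el x y = (\<chi> i. el (x $ i) (y $ i))"

definition twist :: "'a ^ 'k \<Rightarrow> 'a ^ 'k" where
  "twist x = (\<chi> i. \<sigma> (x $ i))"

lemma twist_add: "twist (x + y) = twist x + twist y"
  and twist_scale: "twist (c *s x) = \<sigma> c *s twist x"
  by (simp_all add: twist_def vec_eq_iff \<sigma>_add \<sigma>_diff \<sigma>_mult)

lemma twist_surj: "\<exists>x. y = twist x"
proof
  show "y = twist (\<chi> i. inv_into UNIV \<sigma> (y $ i))"
    using \<sigma>_bij by (simp add: twist_def vec_eq_iff surj_f_inv_f bij_is_surj)
qed

lemma dot_twist: "twist x \<cdot> twist y = \<sigma> (x \<cdot> y)"
  by (simp add: scalar_product_def twist_def \<sigma>_sum \<sigma>_mult)

lemma vec_el_eq_iff [simp]: "vec_el x y = vec_el x' y' \<longleftrightarrow> x = x' \<and> y = y'"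
  by (auto simp: vec_el_def vec_eq_iff)

lemma vec_el_closed [simp]: "vec_el x y \<in> free_module R"
  by (simp add: vec_el_def free_module_def)

lemma free_module_cases:
  fixes z :: "'a poly set ^ 'k"
  assumes "z \<in> free_module R"
  obtains x y where "z = vec_el x y"
proof -
  have "\<forall>i. \<exists>c d. z $ i = el c d"
    using assms unfolding free_module_def mem_Collect_eq by (metis chain_ring_cases)
  then obtain f h where "\<And>i. z $ i = el (f i) (h i)" by metis
  then have "z = vec_el (\<chi> i. f i) (\<chi> i. h i)"
    by (simp add: vec_el_def vec_eq_iff)
  then show ?thesis by (rule that)
qed

lemma vec_el_ops:
  "vadd R (vec_el x y) (vec_el x' y') = vec_el (x + x') (y + y')"
  "vminus R (vec_el x y) (vec_el x' y') = vec_el (x - x') (y - y')"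
  "rscale R (vec_el x y) (el c d) = vec_el (c *s x) (d *s x + \<sigma> c *s y)"
  "lscale R (el c d) (vec_el x y) = vec_el (c *s x) (c *s y + d *s twist x)"
  "vzero R = vec_el 0 0"
  by (simp_all add: vadd_def vminus_def rscale_def lscale_def vzero_def vec_el_def vec_eq_iff
      twist_def el_zero algebra_simps)

lemma mat_vec_embed: "mat_vec R (embed_mat \<sigma> A) (vec_el x y) = vec_el (A *v x) (A *v y)"
  by (simp add: mat_vec_def embed_mat_def vec_el_def vec_eq_iff const_emb_el el_finsum
      matrix_vector_mult_def)

lemma right_span_self: "vec_el x y \<in> right_span R (vec_el x y)"
proof -
  have "vec_el x y = rscale R (vec_el x y) (el 1 0)"
    by (simp add: vec_el_ops)
  then show ?thesis
    unfolding right_span_def using el_closed by blast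
qed

text \<open>Reduction modulo the radical maps the points of the Barbilian space to points of the projective
  plane.\<close>

lemma right_span_reduction:
  assumes "vec_el x y \<in> right_span R (vec_el x' y')"
  shows "\<exists>c. x = c *s x'"
  using assms by (auto simp: right_span_def vec_el_ops elim!: chain_ring_cases)

definition row_functional :: "'a poly set ^ 'k \<Rightarrow> 'a poly set ^ 'k \<Rightarrow> 'a poly set" where
  "row_functional x = (\<lambda>y\<in>free_module R. \<Oplus>\<^bsub>R\<^esub>i\<in>UNIV. x $ i \<otimes>\<^bsub>R\<^esub> y $ i)"

lemma row_functional_el:
  "row_functional (vec_el u v) (vec_el x y) = el (u \<cdot> x) (u \<cdot> y + v \<cdot> twist x)"
  by (simp add: row_functional_def vec_el_def[of u] vec_el_def[of x] el_finsum
      vec_el_closed[unfolded vec_el_def] scalar_product_def twist_def sum.distrib)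

lemma row_functional_mem: "row_functional (vec_el u v) \<in> functionals R"
  unfolding functionals_def
proof (intro CollectI conjI ballI)
  show "row_functional (vec_el u v) \<in> free_module R \<rightarrow>\<^sub>E carrier R"
    by (rule PiE_I) (auto simp: row_functional_el elim!: free_module_cases, auto simp: row_functional_def)
next
  fix z w :: "'a poly set ^ 'b" assume "z \<in> free_module R" "w \<in> free_module R"
  then obtain x y x' y' where "z = vec_el x y" "w = vec_el x' y'" by (metis free_module_cases)
  then show "row_functional (vec_el u v) (vadd R z w) =
      row_functional (vec_el u v) z \<oplus>\<^bsub>R\<^esub> row_functional (vec_el u v) w"
    by (simp add: vec_el_ops row_functional_el dot_linear twist_add)
next
  fix z :: "'a poly set ^ 'b" and r assume "z \<in> free_module R" "r \<in> carrier R"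
  then obtain x y c d where "z = vec_el x y" "r = el c d" by (metis free_module_cases chain_ring_cases)
  then show "row_functional (vec_el u v) (rscale R z r) = row_functional (vec_el u v) z \<otimes>\<^bsub>R\<^esub> r"
    by (simp add: vec_el_ops row_functional_el dot_linear twist_scale algebra_simps)
qed

text \<open>The witness has the form \<open>e\<^sub>i (c + d X)\<close> with \<open>u\<^sub>i \<noteq> 0\<close>: \<open>c\<close> makes the constant part of the value equal to
  \<open>1\<close>, and \<open>d\<close> then cancels the coefficient of \<open>X\<close>.\<close>

lemma hyperplane_row_functional:
  assumes "u \<noteq> 0"
  shows "functional_span R (row_functional (vec_el u v)) \<in> barb_hyperplanes R"
proof -
  obtain i where i: "u $ i \<noteq> 0"
    using assms by (auto simp: vec_eq_iff)
  let ?x = "axis i (1 / u $ i)"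
  let ?y = "axis i (- (v \<cdot> twist ?x) / u $ i)"
  have "row_functional (vec_el u v) (vec_el ?x ?y) = \<one>\<^bsub>R\<^esub>"
    using i by (simp add: row_functional_el dot_axis el_one)
  then show ?thesis
    unfolding barb_hyperplanes_def mem_Collect_eq
    by (intro exI[of _ "row_functional (vec_el u v)"] conjI refl row_functional_mem bexI[OF _ vec_el_closed])
qed

text \<open>Incidence is defined through some pair of generators. Any other generators are multiples of
  these, the point generator on the right and the form on the left, so their value is zero as well.\<close>

lemma lies_on_row_functional:
  "lies_on R (right_span R (vec_el x y)) (functional_span R (row_functional (vec_el u v))) \<longleftrightarrow>
    row_functional (vec_el u v) (vec_el x y) = \<zero>\<^bsub>R\<^esub>"
proof
  interpret ring R by (rule ring_R)
  let ?f = "row_functional (vec_el u v)"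
  assume "lies_on R (right_span R (vec_el x y)) (functional_span R ?f)"
  then obtain z \<phi> where z: "z \<in> free_module R" and \<phi>: "\<phi> \<in> functionals R" "\<phi> z = \<zero>\<^bsub>R\<^esub>"
    and spans: "right_span R (vec_el x y) = right_span R z" "functional_span R ?f = functional_span R \<phi>"
    unfolding lies_on_def by blast
  from spans(1) obtain r where r: "r \<in> carrier R" "vec_el x y = rscale R z r"
    using right_span_self[of x y] by (auto simp: right_span_def)
  have f: "?f \<in> free_module R \<rightarrow>\<^sub>E carrier R"
    using row_functional_mem[of u v] unfolding functionals_def by blast
  then have "?f = (\<lambda>z\<in>free_module R. \<one>\<^bsub>R\<^esub> \<otimes>\<^bsub>R\<^esub> ?f z)"
    by (intro extensionalityI[of _ "free_module R"]) (auto simp: PiE_def Pi_def)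
  then have "?f \<in> functional_span R ?f"
    unfolding functional_span_def by blast
  with spans(2) obtain s where s: "s \<in> carrier R" "?f = (\<lambda>z\<in>free_module R. s \<otimes>\<^bsub>R\<^esub> \<phi> z)"
    by (auto simp: functional_span_def)
  have "?f (vec_el x y) = s \<otimes>\<^bsub>R\<^esub> \<phi> (rscale R z r)"
    by (subst s(2)) (simp add: r(2)[symmetric])
  also have "\<phi> (rscale R z r) = \<phi> z \<otimes>\<^bsub>R\<^esub> r"
    using \<phi>(1) z r(1) unfolding functionals_def by blast
  finally show "?f (vec_el x y) = \<zero>\<^bsub>R\<^esub>"
    using r(1) s(1) by (simp add: \<phi>(2))
next
  assume "row_functional (vec_el u v) (vec_el x y) = \<zero>\<^bsub>R\<^esub>"
  then show "lies_on R (right_span R (vec_el x y)) (functional_span R (row_functional (vec_el u v)))"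
    unfolding lies_on_def
    by (intro bexI[OF _ vec_el_closed] bexI[OF _ row_functional_mem]) simp
qed

text \<open>If the generator were divisible by \<open>X\<close>, every linear form would take a value in the radical on it,
  never \<open>1\<close>.\<close>

lemma barb_point_reduction:
  assumes "p \<in> barb_points R"
  obtains x y where "p = right_span R (vec_el x y)" "x \<noteq> 0"
proof -
  from assms obtain z \<phi> where z: "p = right_span R z" "z \<in> free_module R"
    and \<phi>: "\<phi> \<in> functionals R" "\<phi> z = \<one>\<^bsub>R\<^esub>"
    unfolding barb_points_def by blast
  from z(2) obtain x y where xy: "z = vec_el x y" by (rule free_module_cases)
  have "x \<noteq> 0"
  proof
    assume "x = 0"
    then have "z = rscale R (vec_el y 0) (el 0 1)"
      by (simp add: xy vec_el_ops)
    then have "\<phi> z = \<phi> (vec_el y 0) \<otimes>\<^bsub>R\<^esub> el 0 1"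
      using \<phi>(1) unfolding functionals_def by simp
    moreover have "\<phi> (vec_el y 0) \<in> carrier R"
      using \<phi>(1) unfolding functionals_def by (auto simp: PiE_def Pi_def)
    then obtain c d where "\<phi> (vec_el y 0) = el c d" by (rule chain_ring_cases)
    ultimately show False
      using \<phi>(2) by (simp add: el_one)
  qed
  with z(1) xy that show ?thesis by blast
qed

end

section \<open>The Singer cycle\<close>

lemma GL3_simps: "carrier GL3 = {A. invertible A}" "mult GL3 = (**)" "one GL3 = mat 1"
  by (simp_all add: GL3_def)

lemma group_GL3: "group (GL3 :: ('a::field ^ 3 ^ 3) monoid)"
proof (rule groupI)
  fix A :: "'a ^ 3 ^ 3" assume "A \<in> carrier GL3"
  then obtain B where "A ** B = mat 1" "B ** A = mat 1"
    by (auto simp: GL3_simps invertible_def)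
  then show "\<exists>B\<in>carrier GL3. B \<otimes>\<^bsub>GL3\<^esub> A = \<one>\<^bsub>GL3\<^esub>"
    by (auto simp: GL3_simps invertible_def)
qed (auto simp: GL3_simps invertible_mult matrix_mul_assoc invertible_def[of "mat 1"])

lemma scalar_matrix_mul:
  fixes A :: "'a::field ^ 3 ^ 3"
  shows "mat c ** A = (\<chi> i j. c * A $ i $ j)" "A ** mat c = (\<chi> i j. c * A $ i $ j)"
  by (simp_all add: matrix_matrix_mult_def mat_def vec_eq_iff if_distrib if_distribR
      sum.delta' mult.commute cong: if_cong)

lemma normal_scalars3: "scalars3 \<lhd> (GL3 :: ('a::field ^ 3 ^ 3) monoid)"
proof -
  interpret group "GL3 :: ('a ^ 3 ^ 3) monoid" by (rule group_GL3)
  have mat_mult: "mat c ** mat d = (mat (c * d) :: 'a ^ 3 ^ 3)" for c d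
    by (simp add: scalar_matrix_mul) (simp add: mat_def vec_eq_iff)
  have invertible: "invertible (mat c :: 'a ^ 3 ^ 3)" if "c \<noteq> 0" for c
    using that mat_mult[of c "1 / c"] mat_mult[of "1 / c" c] unfolding invertible_def by auto
  have "subgroup scalars3 (GL3 :: ('a ^ 3 ^ 3) monoid)"
  proof (rule subgroupI)
    fix A :: "'a ^ 3 ^ 3" assume "A \<in> scalars3"
    then obtain c where c: "A = mat c" "c \<noteq> 0" by (auto simp: scalars3_def)
    then have "inv\<^bsub>GL3\<^esub> A = mat (1 / c)"
      by (intro inv_equality) (simp_all add: GL3_simps mat_mult invertible)
    with c show "inv\<^bsub>GL3\<^esub> A \<in> scalars3" by (auto simp: scalars3_def)
  next
    fix A B :: "'a ^ 3 ^ 3" assume "A \<in> scalars3" "B \<in> scalars3"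
    then obtain c d where "A = mat c" "B = mat d" "c \<noteq> 0" "d \<noteq> 0"
      by (auto simp: scalars3_def)
    then show "A \<otimes>\<^bsub>GL3\<^esub> B \<in> scalars3"
      by (auto simp: GL3_simps mat_mult scalars3_def)
  qed (auto simp: scalars3_def GL3_simps invertible intro: exI[of _ 1])
  then show ?thesis
    by (rule normalI) (auto simp: r_coset_def l_coset_def GL3_simps scalars3_def scalar_matrix_mul)
qed

lemma span_single_point: "x \<noteq> 0 \<Longrightarrow> vec.span {x} \<in> pg2_points"
  by (simp add: pg2_points_def vec.subspace_span vec.dim_span)

text \<open>The element of the Singer cycle taking the point of \<open>x\<close> to that of \<open>w\<close> is the class of a matrix in
  \<open>\<langle>S\<rangle>\<close>, because the projection onto the quotient maps \<open>\<langle>S\<rangle>\<close> onto the subgroup generated by the class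
  of \<open>S\<close>.\<close>

lemma singer_transitive:
  assumes S: "induces_singer_cycle S" and x: "x \<noteq> 0" and w: "w \<noteq> 0"
  shows "\<exists>A\<in>generate GL3 {S}. \<exists>c. w = c *s (A *v x)"
proof -
  let ?h = "\<lambda>A. scalars3 #>\<^bsub>GL3\<^esub> A"
  interpret GL: group GL3 by (rule group_GL3)
  interpret normal scalars3 GL3 by (rule normal_scalars3)
  interpret h: group_hom GL3 PGL3 ?h
    unfolding PGL3_def group_hom_def group_hom_axioms_def
    using group_GL3 factorgroup_is_group r_coset_hom_Mod by blast
  have S_carrier: "{S} \<subseteq> carrier GL3"
    using S by (simp add: induces_singer_cycle_def)
  obtain g where g: "g \<in> generate PGL3 {?h S}" "proj_act g (vec.span {x}) = vec.span {w}"
    using S span_single_point[OF x] span_single_point[OF w]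
    unfolding induces_singer_cycle_def singer_cycle_def by blast
  then obtain A where A: "A \<in> generate GL3 {S}" "g = ?h A"
    using h.generate_img[OF S_carrier] by auto
  have "A = mat 1 ** A" "mat 1 \<in> scalars3"
    by (auto simp: scalars3_def intro: exI[of _ 1])
  then have "A \<in> g"
    unfolding A(2) r_coset_def GL3_simps by blast
  then have "A *v x \<in> vec.span {w}"
    unfolding g(2)[symmetric] proj_act_def using vec.span_base[of x "{x}"] by blast
  then obtain c where c: "A *v x = c *s w"
    by (auto simp: vec.span_singleton)
  have "invertible A"
    using GL.generate_in_carrier[OF S_carrier A(1)] by (simp add: GL3_simps)
  then obtain B where B: "B ** A = mat 1" by (auto simp: invertible_def)
  have "c \<noteq> 0"
  proof
    assume "c = 0"
    with c have "B *v (A *v x) = 0" by simp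
    with B x show False by (simp add: matrix_vector_mul_assoc)
  qed
  with c have "w = (1 / c) *s (A *v x)" by (simp add: vector_smult_assoc)
  with A(1) show ?thesis by blast
qed

section \<open>The code and its graph\<close>

theorem corollary6p4:
  fixes \<sigma> :: "'a::{field,finite} \<Rightarrow> 'a"
    and q :: nat
    and R :: "'a poly set ring"
    and S :: "'a ^ 3 ^ 3"
    and p :: "('a poly set ^ 3) set"
    and K :: "('a poly set ^ 3) set set"
    and Y :: "'a poly set ^ 'n::finite ^ 3"
    and C :: "('a poly set ^ 'n) set"
  assumes q: "q = CARD('a)"
    and \<sigma>: "field_aut \<sigma>"
    and R: "R = chain_ring \<sigma>"
    and p: "p \<in> barb_points R"
    and S: "induces_singer_cycle S"
    and K: "K = orbit_of \<sigma> S p"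
    and card_K: "card K = q^2 + q + 1"
    and hyperplanes: "\<And>H. H \<in> barb_hyperplanes R \<Longrightarrow> card {P \<in> K. lies_on R P H} \<in> {1, q + 1}"
    and n: "CARD('n) = q^2 + q + 1"
    and Y_carrier: "\<And>i j. Y $ i $ j \<in> carrier R"
    and Y_columns: "bij_betw (\<lambda>j. right_span R (column j Y)) UNIV K"
    and C: "C = {vec_mat R x Y | x. x \<in> free_module R}"
  shows "two_weight_code R C (real q ^ 3 / (real q - 1)) (real q ^ 2) \<and>
         strongly_regular C (\<lambda>x y. w_hom_vec R (vminus R x y) = real q ^ 2)
           (q^6) (q^4 - q) (q^3 + q^2 - 3 * q) (q^2 - q)"
proof -
  interpret skew_chain_ring \<sigma> by unfold_locales (rule \<sigma>)
  obtain x0 y0 where p_eq: "p = right_span R (vec_el x0 y0)" and "x0 \<noteq> 0"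
    using barb_point_reduction[OF p[unfolded R]] unfolding R .
  have "\<exists>x y. column j Y = vec_el x y" for j
  proof -
    have "column j Y \<in> free_module (chain_ring \<sigma>)"
      using Y_carrier by (simp add: R free_module_def column_def)
    then show ?thesis by (rule free_module_cases) blast
  qed
  then obtain a b where col: "\<And>j. column j Y = vec_el (a j) (b j)" by metis
  \<comment> \<open>Chosen so that entry \<open>j\<close> vanishes iff \<open>u \<cdot> a j = 0\<close> and \<open>v \<cdot> a j = g j u\<close>.\<close>
  define g where "g j u = inv_into UNIV \<sigma> (- (u \<cdot> b j))" for j u
  have \<sigma>_g: "\<sigma> (g j u) = - (u \<cdot> b j)" for j u
    using \<sigma>_bij by (simp add: g_def surj_f_inv_f bij_is_surj)
  have \<sigma>_inj: "\<sigma> s = \<sigma> t \<longleftrightarrow> s = t" for s t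
    using \<sigma>_bij by (simp add: bij_is_inj inj_eq)
  have entry: "row_functional (vec_el u (twist v)) (column j Y) = el (u \<cdot> a j) (\<sigma> (v \<cdot> a j - g j u))" for u v j
    by (simp add: col row_functional_el dot_twist \<sigma>_diff \<sigma>_g)
  have zero_iff: "row_functional (vec_el u (twist v)) (column j Y) = \<zero>\<^bsub>R\<^esub> \<longleftrightarrow>
      u \<cdot> a j = 0 \<and> v \<cdot> a j = g j u" for u v j
    by (simp add: R entry el_zero)

  have cover: "\<exists>j c. w = c *s a j" if w: "w \<noteq> 0" for w
  proof -
    obtain A c where A: "A \<in> generate GL3 {S}" "w = c *s (A *v x0)"
      using singer_transitive[OF S \<open>x0 \<noteq> 0\<close> w] by blast
    have "right_span R (vec_el (A *v x0) (A *v y0)) \<in> K"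
      unfolding K orbit_of_def mem_Collect_eq using A(1) p_eq
      by (intro exI[of _ A] exI[of _ "vec_el x0 y0"]) (simp add: R mat_vec_embed)
    then obtain j where "right_span R (vec_el (A *v x0) (A *v y0)) = right_span R (column j Y)"
      using Y_columns unfolding bij_betw_def by blast
    then have "vec_el (A *v x0) (A *v y0) \<in> right_span R (vec_el (a j) (b j))"
      using right_span_self[of "A *v x0" "A *v y0"] by (simp add: col R)
    then obtain d where "A *v x0 = d *s a j"
      using right_span_reduction unfolding R by blast
    with A(2) have "w = (c * d) *s a j" by (simp add: vector_smult_assoc)
    then show ?thesis by blast
  qed

  have secant: "card {j. u \<cdot> a j = 0 \<and> v \<cdot> a j = g j u} \<in> {1, q + 1}" if "u \<noteq> 0" for u v
  proof -
    let ?H = "functional_span R (row_functional (vec_el u (twist v)))"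
    have "lies_on R (right_span R (column j Y)) ?H \<longleftrightarrow> u \<cdot> a j = 0 \<and> v \<cdot> a j = g j u" for j
      using zero_iff[of u v j] by (simp add: col R lies_on_row_functional)
    then have "bij_betw (\<lambda>j. right_span R (column j Y)) {j. u \<cdot> a j = 0 \<and> v \<cdot> a j = g j u}
        {P \<in> K. lies_on R P ?H}"
      by (intro bij_betw_subset[OF Y_columns]) (use Y_columns in \<open>auto simp: bij_betw_def\<close>)
    then have "card {j. u \<cdot> a j = 0 \<and> v \<cdot> a j = g j u} = card {P \<in> K. lies_on R P ?H}"
      by (rule bij_betw_same_card)
    moreover have "?H \<in> barb_hyperplanes R"
      using hyperplane_row_functional[OF that] by (simp add: R)
    ultimately show ?thesis using hyperplanes by simp
  qed

  interpret secant_lift q a g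
  proof
    show "g j (x + y) = g j x + g j y" for j x y
      using \<sigma>_inj[of "g j (x + y)" "g j x + g j y"] by (simp add: \<sigma>_g \<sigma>_add dot_linear)
  qed (use q n cover secant in auto)

  \<comment> \<open>Twisting \<open>v\<close> turns the radical part of an entry into the image under \<open>\<sigma>\<close> of an expression affine in \<open>v\<close>.\<close>
  define word where "word = (\<lambda>(u, v). vec_mat R (vec_el u (twist v)) Y)"
  have vec_mat_nth: "vec_mat R (vec_el u v) Y $ j = row_functional (vec_el u v) (column j Y)" for u v j
  proof -
    have "column j Y \<in> free_module (chain_ring \<sigma>)" by (simp add: col)
    then show ?thesis by (simp add: vec_mat_def row_functional_def R) (simp add: column_def)
  qed
  have word_nth: "word (u, v) $ j = el (u \<cdot> a j) (\<sigma> (v \<cdot> a j - g j u))" for u v j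
    by (simp add: word_def vec_mat_nth entry)
  have C_word: "C = range word"
  proof (intro equalityI subsetI)
    fix c assume "c \<in> C"
    then obtain x where x: "x \<in> free_module R" "c = vec_mat R x Y" by (auto simp: C)
    then obtain u v where "x = vec_el u v" unfolding R by (metis free_module_cases)
    moreover obtain v' where "v = twist v'" using twist_surj by blast
    ultimately have "c = word (u, v')" by (simp add: x word_def)
    then show "c \<in> range word" by blast
  qed (auto simp: C word_def R)

  have word_diff: "vminus R (word d) (word e) = word (d - e)" for d e
    by (cases d; cases e) (simp add: vminus_def vec_eq_iff word_nth R dot_linear g_diff \<sigma>_diff \<sigma>_add algebra_simps)
  have word_0: "word 0 = vzero R"
    by (simp add: vzero_def vec_eq_iff word_nth R el_zero zero_prod_def dot_linear g_zero)
  have weight: "w_hom_vec R (word d) = (if d = 0 then 0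
      else if d \<in> connection then real q ^ 2 else real q ^ 3 / (real q - 1))" for d
  proof (cases d)
    case (Pair u v)
    have "w_hom_vec R (word d) = (\<Sum>j\<in>UNIV. if u \<cdot> a j \<noteq> 0 then 1
        else if v \<cdot> a j \<noteq> g j u then real q / (real q - 1) else 0)"
      unfolding w_hom_vec_def Pair word_nth R w_hom_el by (intro sum.cong refl) (simp add: q)
    then show ?thesis by (simp only: sum_entry_weights Pair zero_prod_def)
  qed
  have weights_pos: "real q ^ 2 > 0" "real q ^ 3 / (real q - 1) > 0"
    using real_q by simp_all
  have weights_neq: "real q ^ 3 / (real q - 1) \<noteq> real q ^ 2"
    using real_q by (simp add: field_simps power3_eq_cube power2_eq_square)
  \<comment> \<open>All nonzero pairs have positive weight, so encoding is injective.\<close>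
  have word_eq_iff: "word d = word e \<longleftrightarrow> d = e" for d e
  proof
    assume "word d = word e"
    then have "word (d - e) = word (d - d)" by (metis word_diff)
    then have "w_hom_vec R (word (d - e)) = 0" by (simp add: weight)
    then show "d = e" using weights_pos by (auto simp: weight split: if_splits)
  qed simp
  have word_bij: "bij_betw word UNIV C"
    by (simp add: bij_betw_def inj_on_def word_eq_iff C_word)

  have linear: "linear_code R C"
    unfolding linear_code_def
  proof (intro conjI ballI)
    show "C \<subseteq> free_module R"
      by (auto simp: C_word free_module_def word_nth R)
    show "vzero R \<in> C"
      by (simp add: C_word flip: word_0)
  next
    fix x y assume "x \<in> C" "y \<in> C"
    then obtain d e where "x = word d" "y = word e" by (auto simp: C_word)
    then have "vadd R x y = word (d + e)"
      by (cases d; cases e) (simp add: vadd_def vec_eq_iff word_nth R dot_linear g_add \<sigma>_add \<sigma>_diff algebra_simps)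
    then show "vadd R x y \<in> C" by (simp add: C_word)
  next
    fix r x assume "r \<in> carrier R" "x \<in> C"
    then obtain c d z where r: "r = el c d" and z: "z \<in> free_module R" "x = vec_mat R z Y"
      unfolding C mem_Collect_eq using R chain_ring_cases by blast
    then obtain u v where uv: "z = vec_el u v" unfolding R by (metis free_module_cases)
    have "lscale R r x $ j = vec_mat R (lscale R r z) Y $ j" for j
    proof -
      have "lscale R r x $ j = r \<otimes>\<^bsub>R\<^esub> vec_mat R (vec_el u v) Y $ j"
        by (simp add: lscale_def z(2) uv)
      also have "\<dots> = vec_mat R (lscale R r z) Y $ j"
        by (simp add: R r uv vec_el_ops vec_mat_nth[unfolded R] col row_functional_el dot_linear
            dot_twist algebra_simps)
      finally show ?thesis .
    qed
    then have "lscale R r x = vec_mat R (lscale R r z) Y"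
      by (simp add: vec_eq_iff)
    moreover have "lscale R r z \<in> free_module R"
      by (simp add: R r uv vec_el_ops)
    ultimately show "lscale R r x \<in> C"
      by (auto simp: C)
  qed

  have vertical: "(0, axis 0 1) \<noteq> (0 :: ('a ^ 3) \<times> ('a ^ 3))" "(0, axis 0 1) \<notin> connection"
    by (simp_all add: zero_prod_def connection_def)
  obtain v where "v \<in> full_lifts (axis 0 1)" using full_lifts_nonempty[of "axis 0 1"] by auto
  then have conn: "(axis 0 1, v) \<in> connection" by (simp add: connection_def)
  have "w_hom_vec R ` C - {0} = {real q ^ 3 / (real q - 1), real q ^ 2}"
  proof (intro equalityI subsetI)
    fix r assume r: "r \<in> {real q ^ 3 / (real q - 1), real q ^ 2}"
    have "w_hom_vec R (word (0, axis 0 1)) = real q ^ 3 / (real q - 1)"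
      "w_hom_vec R (word (axis 0 1, v)) = real q ^ 2"
      using vertical conn by (simp_all add: weight) (simp add: zero_prod_def connection_def)
    with r have "r \<in> range (\<lambda>d. w_hom_vec R (word d))"
      by (metis insertE rangeI singletonD)
    then show "r \<in> w_hom_vec R ` C - {0}"
      using r weights_pos by (auto simp: C_word image_image)
  qed (auto simp: C_word weight split: if_splits)
  moreover have "w_hom_vec R c > 0" if "c \<in> C" "c \<noteq> vzero R" for c
  proof -
    from that obtain d where "c = word d" "d \<noteq> 0" using word_0 unfolding C_word by blast
    then show ?thesis using weights_pos by (simp add: weight)
  qed
  ultimately have "two_weight_code R C (real q ^ 3 / (real q - 1)) (real q ^ 2)"
    unfolding two_weight_code_def using linear weights_neq by blast
  moreover have "strongly_regular C (\<lambda>x y. w_hom_vec R (vminus R x y) = real q ^ 2)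
      (q ^ 6) (q ^ 4 - q) (q ^ 3 + q ^ 2 - 3 * q) (q ^ 2 - q)"
  proof (rule strongly_regular_transfer[OF word_bij _ connection_srg])
    fix d e
    have "0 \<notin> connection" by (simp add: connection_def zero_prod_def)
    then show "w_hom_vec R (vminus R (word d) (word e)) = real q ^ 2 \<longleftrightarrow> d - e \<in> connection"
      using weights_pos weights_neq by (auto simp: word_diff weight)
  qed
  ultimately show ?thesis ..
qed

end
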